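(* Let $\Phi=(A;\{E_i\}_{i=0}^d;A^*;\{E_i^*\}_{i=0}^d)$ be a tridiagonal system of diameter $d\geq 1$ on $V$ over $\mathbb{K}$, and let $\Psi\in\mathrm{End}(V)$ be the linear transformation attached to $\Phi$ as defined in the context. Then $$\Psi E_iV\subseteq E_{i-1}V+E_iV+E_{i+1}V\qquad(0\le i\le d).$$
   Context: $\mathbb{K}$ is a field, $V$ is a $\mathbb{K}$-vector space of finite positive dimension, $\mathrm{End}(V)$ is the algebra of linear maps $V\to V$. A tridiagonal pair (TD pair) on $V$ is an ordered pair $A,A^*\in\mathrm{End}(V)$ ($A^*$ is just a name, not an adjoint) such that: (i) $A$ and $A^*$ are each diagonalizable over $\mathbb{K}$; (ii) there is an ordering $\{V_i\}_{i=0}^d$ of the eigenspaces of $A$ with $A^*V_i\subseteq V_{i-1}+V_i+V_{i+1}$ for $0\le i\le d$, where $V_{-1}=V_{d+1}=0$; (iii) there is an ordering $\{V_i^*\}_{i=0}^{\delta}$ of the eigenspaces of $A^*$ with $AV_i^*\subseteq V_{i-1}^*+V_i^*+V_{i+1}^*$ for $0\le i\le\delta$, where $V_{-1}^*=V_{\delta+1}^*=0$; (iv) there is no subspace $W$ of $V$ with $AW\subseteq W$, $A^*W\subseteq W$, $W\ne0$, $W\ne V$. It is known that $d=\delta$; this is the diameter, and it is assumed that $d\ge1$. Orderings satisfying (ii) (resp. (iii)) are called standard. The primitive idempotent of a diagonalizable map associated with one of its eigenspaces is the projection of $V$ onto that eigenspace that kills the other eigenspaces. A tridiagonal system (TD system)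 on $V$ is a sequence $\Phi=(A;\{E_i\}_{i=0}^d;A^*;\{E_i^*\}_{i=0}^d)$ where $A,A^*$ is a TD pair on $V$, $\{E_i\}_{i=0}^d$ is an ordering of the primitive idempotents of $A$ such that $\{E_iV\}_{i=0}^d$ is standard, and $\{E_i^*\}_{i=0}^d$ is an ordering of the primitive idempotents of $A^*$ such that $\{E_i^*V\}_{i=0}^d$ is standard. Set $E_{-1}=E_{d+1}=0$. Let $\theta_i$ be the eigenvalue of $A$ on $E_iV$. For $0\le i\le d/2$ set $K_i=(E_0^*V+\cdots+E_i^*V)\cap(E_iV+E_{i+1}V+\cdots+E_{d-i}V)$. For $0\le i\le j\le d+1$ set $\tau_{ij}=(x-\theta_i)(x-\theta_{i+1})\cdots(x-\theta_{j-1})\in\mathbb{K}[x]$, with $\tau_{ii}=1$ and $\tau_{i,i-1}=0$. For $0\le i\le d+1$ set $\vartheta_i=\sum_{h=0}^{i-1}\frac{\theta_h-\theta_{d-h}}{\theta_0-\theta_d}$. It is known that $V=\bigoplus_{0\le i\le d/2}\bigoplus_{j=i}^{d-i}\tau_{ij}(A)K_i$. $\Psi$ is the unique element of $\mathrm{End}(V)$ such that $\Psi\tau_{ij}(A)v=(\vartheta_j-\vartheta_i)\tau_{i,j-1}(A)v$ for all $0\le i\le d/2$, $i\le j\le d-i$, $v\in K_i$. *)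

theory Defs
  imports
    Complex_Main
    "HOL-Library.Set_Algebras"
    "HOL-Computational_Algebra.Polynomial"
begin

text \<open>
  The vector space \<open>V\<close> is the whole type \<open>'v\<close>, with scalar multiplication \<open>scale\<close> over the
  field \<open>'k\<close>, and \<open>End(V)\<close> consists of the \<open>f\<close> with \<open>Vector_Spaces.linear scale scale f\<close>.
  Sums of subspaces are sums of sets in the sense of \<open>Set_Algebras\<close>; the zero of that addition,
  and hence the empty sum, is \<open>{0}\<close>.
\<close>

type_synonym ('k, 'v) scaling = "'k \<Rightarrow> 'v \<Rightarrow> 'v"

definition eigenspace ::
    "('k::field, 'v::ab_group_add) scaling \<Rightarrow> ('v \<Rightarrow> 'v) \<Rightarrow> 'k \<Rightarrow> 'v set" where
  "eigenspace scale A t = {v. A v = scale t v}"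

definition eigenspaces ::
    "('k::field, 'v::ab_group_add) scaling \<Rightarrow> ('v \<Rightarrow> 'v) \<Rightarrow> 'v set set" where
  "eigenspaces scale A = {W. W \<noteq> {0} \<and> (\<exists>t. W = eigenspace scale A t)}"

definition diagonalizable ::
    "('k::field, 'v::ab_group_add) scaling \<Rightarrow> ('v \<Rightarrow> 'v) \<Rightarrow> bool" where
  "diagonalizable scale A \<longleftrightarrow>
     Vector_Spaces.linear scale scale A \<and>
     module.span scale (\<Union>(eigenspaces scale A)) = UNIV"

text \<open>
  A family of subspaces is indexed by naturals, of which only \<open>0, \<dots>, d\<close> are relevant;
  \<open>zero_ext d U\<close> extends it to integer indices by zero, so that \<open>U\<^bsub>-1\<^esub> = U\<^bsub>d+1\<^esub> = 0\<close>.
\<close>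

definition zero_ext :: "nat \<Rightarrow> (nat \<Rightarrow> 'v::ab_group_add set) \<Rightarrow> int \<Rightarrow> 'v set" where
  "zero_ext d U k = (if 0 \<le> k \<and> k \<le> int d then U (nat k) else {0})"

definition adjacent_sum :: "nat \<Rightarrow> (nat \<Rightarrow> 'v::ab_group_add set) \<Rightarrow> nat \<Rightarrow> 'v set" where
  "adjacent_sum d U i =
     zero_ext d U (int i - 1) + zero_ext d U (int i) + zero_ext d U (int i + 1)"

definition standard_ordering ::
    "('k::field, 'v::ab_group_add) scaling \<Rightarrow> ('v \<Rightarrow> 'v) \<Rightarrow> ('v \<Rightarrow> 'v) \<Rightarrow> nat \<Rightarrow>
     (nat \<Rightarrow> 'v set) \<Rightarrow> bool" where
  "standard_ordering scale A B d U \<longleftrightarrow>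
     bij_betw U {..d} (eigenspaces scale A) \<and> (\<forall>i\<le>d. B ` U i \<subseteq> adjacent_sum d U i)"

definition td_pair ::
    "('k::field, 'v::ab_group_add) scaling \<Rightarrow> ('v \<Rightarrow> 'v) \<Rightarrow> ('v \<Rightarrow> 'v) \<Rightarrow> bool" where
  "td_pair scale A As \<longleftrightarrow>
     diagonalizable scale A \<and> diagonalizable scale As \<and>
     (\<exists>d U. standard_ordering scale A As d U) \<and>
     (\<exists>\<delta> Us. standard_ordering scale As A \<delta> Us) \<and>
     \<not> (\<exists>W. module.subspace scale W \<and> A ` W \<subseteq> W \<and> As ` W \<subseteq> W \<and> W \<noteq> {0} \<and> W \<noteq> UNIV)"

definition primitive_idempotents ::
    "('k::field, 'v::ab_group_add) scaling \<Rightarrow> ('v \<Rightarrow> 'v) \<Rightarrow> ('v \<Rightarrow> 'v) set" where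
  "primitive_idempotents scale A =
     {P. Vector_Spaces.linear scale scale P \<and>
         (\<exists>W \<in> eigenspaces scale A. (\<forall>v\<in>W. P v = v) \<and>
            (\<forall>W' \<in> eigenspaces scale A. W' \<noteq> W \<longrightarrow> (\<forall>v\<in>W'. P v = 0)))}"

text \<open>
  Of the sequences \<open>E\<close> and \<open>Es\<close> only the entries \<open>0, \<dots>, d\<close> are relevant; \<open>E\<^sub>iV\<close> is \<open>range (E i)\<close>.
\<close>

definition td_system ::
    "('k::field, 'v::ab_group_add) scaling \<Rightarrow> nat \<Rightarrow> ('v \<Rightarrow> 'v) \<Rightarrow> (nat \<Rightarrow> 'v \<Rightarrow> 'v) \<Rightarrow>
     ('v \<Rightarrow> 'v) \<Rightarrow> (nat \<Rightarrow> 'v \<Rightarrow> 'v) \<Rightarrow> bool" where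
  "td_system scale d A E As Es \<longleftrightarrow>
     td_pair scale A As \<and>
     bij_betw E {..d} (primitive_idempotents scale A) \<and>
     standard_ordering scale A As d (\<lambda>i. range (E i)) \<and>
     bij_betw Es {..d} (primitive_idempotents scale As) \<and>
     standard_ordering scale As A d (\<lambda>i. range (Es i))"

definition theta ::
    "('k::field, 'v::ab_group_add) scaling \<Rightarrow> ('v \<Rightarrow> 'v) \<Rightarrow> (nat \<Rightarrow> 'v \<Rightarrow> 'v) \<Rightarrow> nat \<Rightarrow> 'k" where
  "theta scale A E i = (THE t. range (E i) = eigenspace scale A t)"

definition K_space ::
    "nat \<Rightarrow> (nat \<Rightarrow> 'v \<Rightarrow> 'v) \<Rightarrow> (nat \<Rightarrow> 'v \<Rightarrow> 'v) \<Rightarrow> nat \<Rightarrow> 'v::ab_group_add set" where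
  "K_space d E Es i = (\<Sum>h\<in>{..i}. range (Es h)) \<inter> (\<Sum>h\<in>{i..d - i}. range (E h))"

text \<open>The value \<open>p(A)\<close> of a polynomial at a linear map.\<close>

definition poly_map ::
    "('k::field, 'v::ab_group_add) scaling \<Rightarrow> 'k poly \<Rightarrow> ('v \<Rightarrow> 'v) \<Rightarrow> 'v \<Rightarrow> 'v" where
  "poly_map scale p A v = (\<Sum>n\<le>degree p. scale (coeff p n) ((A ^^ n) v))"

text \<open>The second index is an integer to allow for \<open>\<tau>\<^bsub>i,i-1\<^esub> = 0\<close> when \<open>i = 0\<close>.\<close>

definition tau :: "(nat \<Rightarrow> 'k::field) \<Rightarrow> nat \<Rightarrow> int \<Rightarrow> 'k poly" where
  "tau \<theta> i j = (if j < int i then 0 else (\<Prod>h\<in>{i..<nat j}. [:- \<theta> h, 1:]))"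

definition vartheta :: "nat \<Rightarrow> (nat \<Rightarrow> 'k::field) \<Rightarrow> nat \<Rightarrow> 'k" where
  "vartheta d \<theta> i = (\<Sum>h<i. (\<theta> h - \<theta> (d - h)) / (\<theta> 0 - \<theta> d))"

text \<open>
  The defining property of \<open>\<Psi>\<close>. For a TD system of diameter \<open>d \<ge> 1\<close> exactly one map has it,
  because \<open>V\<close> is the direct sum of the spaces \<open>\<tau>\<^bsub>ij\<^esub>(A)K\<^sub>i\<close>.
\<close>

definition is_Psi ::
    "('k::field, 'v::ab_group_add) scaling \<Rightarrow> nat \<Rightarrow> ('v \<Rightarrow> 'v) \<Rightarrow> (nat \<Rightarrow> 'v \<Rightarrow> 'v) \<Rightarrow>
     (nat \<Rightarrow> 'v \<Rightarrow> 'v) \<Rightarrow> ('v \<Rightarrow> 'v) \<Rightarrow> bool" where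
  "is_Psi scale d A E Es \<Psi> \<longleftrightarrow>
     Vector_Spaces.linear scale scale \<Psi> \<and>
     (let \<theta> = theta scale A E in
      \<forall>i j. 2 * i \<le> d \<longrightarrow> i \<le> j \<longrightarrow> j \<le> d - i \<longrightarrow>
        (\<forall>v \<in> K_space d E Es i.
           \<Psi> (poly_map scale (tau \<theta> i (int j)) A v) =
             scale (vartheta d \<theta> j - vartheta d \<theta> i)
               (poly_map scale (tau \<theta> i (int j - 1)) A v)))"

end

theory Submission
  imports Defs
begin

text \<open>
  Write \<open>V\<^sub>i = E\<^sub>iV\<close> and \<open>V*\<^sub>i = E*\<^sub>iV\<close>.  Tridiagonality of \<open>\<Psi>\<close> is the conjunction of two inclusions:
  \<open>\<Psi>\<close> maps \<open>V\<^sub>j + \<dots> + V\<^sub>d\<close> into \<open>V\<^bsub>j-1\<^esub> + \<dots> + V\<^sub>d\<close>, and \<open>V\<^sub>0 + \<dots> + V\<^sub>j\<close> into \<open>V\<^sub>0 + \<dots> + V\<^bsub>j+1\<^esub>\<close>.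
  The second is the first for the system in which the eigenspaces of \<open>A\<close> are listed backwards.

  The first inclusion comes from the split decomposition.  Put
  \<open>U\<^sub>i = (V*\<^sub>0 + \<dots> + V*\<^sub>i) \<inter> (V\<^sub>i + \<dots> + V\<^sub>d)\<close>.  The map \<open>A - \<theta>\<^sub>i\<close> sends \<open>U\<^sub>i\<close> to \<open>U\<^bsub>i+1\<^esub>\<close>, the map
  \<open>A* - \<theta>*\<^sub>i\<close> sends \<open>U\<^sub>i\<close> to \<open>U\<^bsub>i-1\<^esub>\<close>, and irreducibility forces the \<open>U\<^sub>i\<close> to span \<open>V\<close>, those with index
  at least \<open>j\<close> spanning \<open>V\<^sub>j + \<dots> + V\<^sub>d\<close> (\<open>upper_in_span_corners\<close>).  For \<open>i \<le> d/2\<close> the map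
  \<open>\<tau>\<^bsub>i,d-i\<^esub>(A)\<close> is a bijection from \<open>U\<^sub>i\<close> to \<open>U\<^bsub>d-i\<^esub>\<close>, just as a power of the raising operator is between
  opposite weight spaces of an \<open>sl\<^sub>2\<close>-module.  The space \<open>K\<^sub>i\<close> consists of the lowest weight vectors in
  \<open>U\<^sub>i\<close>, whence \<open>U\<^sub>j\<close> is spanned by the vectors \<open>\<tau>\<^bsub>ij\<^esub>(A)v\<close> with \<open>v \<in> K\<^sub>i\<close> (\<open>corner_generated\<close>).  By its
  definition \<open>\<Psi>\<close> then maps \<open>U\<^sub>j\<close> into \<open>U\<^bsub>j-1\<^esub>\<close>, and the inclusion follows (\<open>lowering_shifts_upper\<close>).

  Reversing the list of eigenspaces of \<open>A\<close> leaves \<open>K\<^sub>i\<close> unchanged, but replaces the polynomials \<open>\<tau>\<^bsub>ij\<^esub>\<close>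
  by \<open>\<eta>\<^bsub>ij\<^esub> = (x - \<theta>\<^bsub>d-i\<^esub>) \<dots> (x - \<theta>\<^bsub>d-j+1\<^esub>)\<close>.  It must therefore be shown that \<open>\<Psi>\<close> lowers the vectors
  \<open>\<eta>\<^bsub>ij\<^esub>(A)v\<close> with the same coefficients \<open>\<vartheta>\<^sub>j - \<vartheta>\<^sub>i\<close>.  This rests on a cubic relation
  \<open>A\<^sup>2\<Psi> - \<beta>A\<Psi>A + \<Psi>A\<^sup>2 - \<gamma>(A\<Psi> + \<Psi>A) - \<rho>\<Psi> = \<kappa>A + \<mu>\<close>
  valid on the vectors \<open>p(A)v\<close> with \<open>v \<in> K\<^sub>i\<close> and \<open>deg p \<le> d - 2i - 2\<close>.  Read along the vectors
  \<open>\<tau>\<^bsub>ij\<^esub>(A)v\<close> it is equivalent to the lowering rule for \<open>\<tau>\<close>, read along \<open>\<eta>\<^bsub>ij\<^esub>(A)v\<close> to the lowering rule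
  for \<open>\<eta>\<close>; and the constants \<open>\<kappa>\<close> and \<open>\<mu>\<close> are the same in both readings
  (\<open>lowering_independent_of_direction\<close>).

  The relation requires the eigenvalues to satisfy a recurrence
  \<open>\<theta>\<^bsub>i+1\<^esub> - \<beta>\<theta>\<^sub>i + \<theta>\<^bsub>i-1\<^esub> = \<gamma>\<close>.  For
  \<open>d \<ge> 3\<close> it follows from writing \<open>A\<^sup>2A*A - AA*A\<^sup>2\<close> as a commutator \<open>XA* - A*X\<close> with
  \<open>X\<close> a polynomial in \<open>A\<close>, and using the action on \<open>V*\<^sub>0\<close> to see that this polynomial is cubic
  (\<open>eigenvalue_relation_of_diameter_ge_3\<close>).

  Throughout, a vector is described by its components \<open>E\<^sub>hv\<close>: sums of eigenspaces become vanishing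
  conditions on components, and an identity between polynomials in \<open>A\<close> becomes an identity between
  their values at the eigenvalues.
\<close>

section \<open>Diagonalizable maps in coordinates\<close>

context vector_space
begin

lemma linear_rules:
  assumes "Vector_Spaces.linear scale scale f"
  shows "f 0 = 0" "f (- x) = - f x" "f (x + y) = f x + f y" "f (x - y) = f x - f y"
    "f (scale c x) = scale c (f x)" "f (sum g S) = (\<Sum>a\<in>S. f (g a))"
  using assms[unfolded linear_iff_module_hom]
  by (simp_all add: module_hom.zero module_hom.neg module_hom.add module_hom.diff
      module_hom.scale module_hom.sum)

lemma span_le_subspace: "x \<in> span S \<Longrightarrow> subspace T \<Longrightarrow> S \<subseteq> T \<Longrightarrow> x \<in> T"
  using span_minimal by blast

lemma linear_maps_span:
  assumes f: "Vector_Spaces.linear scale scale f" and T: "subspace T"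
    and x: "x \<in> span S" and S: "\<And>v. v \<in> S \<Longrightarrow> f v \<in> T"
  shows "f x \<in> T"
proof -
  have "subspace {v. f v \<in> T}"
    using T by (auto simp: subspace_def linear_rules[OF f])
  then show ?thesis using span_le_subspace[OF x] S by blast
qed

end

lemma (in finite_dimensional_vector_space) endo_injective_on_subspace_surjective:
  assumes f: "Vector_Spaces.linear scale scale f" and S: "subspace S"
    and into: "\<And>v. v \<in> S \<Longrightarrow> f v \<in> S"
    and ker: "\<And>v. v \<in> S \<Longrightarrow> f v = 0 \<Longrightarrow> v = 0"
  shows "f ` S = S"
proof (rule subspace_dim_equal)
  have fh: "module_hom scale scale f" using f by (simp add: linear_iff_module_hom)
  show "subspace (f ` S)" using module_hom.subspace_image[OF fh S] .
  show "subspace S" by fact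
  show "f ` S \<subseteq> S" using into by blast
  have "span S = S" using S by simp
  then have "inj_on f (span S)"
    unfolding \<open>span S = S\<close> using ker module_hom.inj_on_iff_eq_0[OF fh S] by blast
  moreover have "finite_dimensional_vector_space_pair_1 scale Basis scale" by unfold_locales
  ultimately show "dim S \<le> dim (f ` S)"
    using finite_dimensional_vector_space_pair_1.dim_image_eq[OF _ f] by fastforce
qed

text \<open>
  The family \<open>E\<close> is taken as data because every argument below compares components \<open>E\<^sub>hv\<close>.
\<close>

locale spectral_resolution = vector_space scale
  for scale :: "'k::field \<Rightarrow> 'v::ab_group_add \<Rightarrow> 'v" +
  fixes A :: "'v \<Rightarrow> 'v" and E :: "nat \<Rightarrow> 'v \<Rightarrow> 'v" and \<theta> :: "nat \<Rightarrow> 'k" and d :: nat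
  assumes linear_A: "Vector_Spaces.linear scale scale A"
    and linear_E: "i \<le> d \<Longrightarrow> Vector_Spaces.linear scale scale (E i)"
    and E_E: "i \<le> d \<Longrightarrow> j \<le> d \<Longrightarrow> E i (E j v) = (if i = j then E j v else 0)"
    and sum_E: "(\<Sum>i\<le>d. E i v) = v"
    and E_A: "i \<le> d \<Longrightarrow> E i (A v) = scale (\<theta> i) (E i v)"
    and inj_eigenvalues: "inj_on \<theta> {..d}"
begin

lemmas A_rules = linear_rules[OF linear_A]
lemmas E_rules = linear_rules[OF linear_E]

lemma eq_by_coordinates: "(\<And>h. h \<le> d \<Longrightarrow> E h v = E h w) \<Longrightarrow> v = w"
  using sum_E[of v] sum_E[of w] by (metis (no_types, lifting) atMost_iff sum.cong)

abbreviation at_A :: "'k poly \<Rightarrow> 'v \<Rightarrow> 'v" where "at_A p \<equiv> poly_map scale p A"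

lemma E_funpow: "h \<le> d \<Longrightarrow> E h ((A ^^ n) v) = scale (\<theta> h ^ n) (E h v)"
  by (induction n) (simp_all add: E_A)

lemma E_at_A: "h \<le> d \<Longrightarrow> E h (at_A p v) = scale (poly p (\<theta> h)) (E h v)"
  by (simp add: poly_map_def E_rules E_funpow poly_altdef scale_sum_left)

lemma linear_at_A: "Vector_Spaces.linear scale scale (at_A p)"
proof -
  have "at_A p (x + y) = at_A p x + at_A p y" "at_A p (scale c x) = scale c (at_A p x)" for x y c
    by (rule eq_by_coordinates; simp add: E_at_A E_rules algebra_simps)+
  then show ?thesis using vector_space_axioms by (simp add: Vector_Spaces.linear_iff)
qed

lemmas at_A_rules = linear_rules[OF linear_at_A]

lemma at_A_mult: "at_A (p * q) v = at_A p (at_A q v)"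
  by (rule eq_by_coordinates) (simp add: E_at_A)

text \<open>
  These are the partial sums \<open>V\<^sub>j + \<dots> + V\<^sub>d\<close> and \<open>V\<^sub>0 + \<dots> + V\<^sub>j\<close> of the eigenspaces.  For \<open>j > d\<close> the first
  is zero and the second is everything, so that shifting an index out of range is harmless.
\<close>

definition upper :: "nat \<Rightarrow> 'v set" where
  "upper j = {v. \<forall>h\<le>d. h < j \<longrightarrow> E h v = 0}"

definition lower :: "nat \<Rightarrow> 'v set" where
  "lower j = {v. \<forall>h\<le>d. j < h \<longrightarrow> E h v = 0}"

lemma subspace_upper: "subspace (upper j)" and subspace_lower: "subspace (lower j)"
  by (auto simp: upper_def lower_def subspace_def E_rules)

lemma upper_mono: "i \<le> j \<Longrightarrow> upper j \<subseteq> upper i"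
  and lower_mono: "i \<le> j \<Longrightarrow> lower i \<subseteq> lower j"
  by (auto simp: upper_def lower_def)

lemma upper_beyond: "d < j \<Longrightarrow> v \<in> upper j \<Longrightarrow> v = 0"
  by (rule eq_by_coordinates) (auto simp: upper_def E_rules)

lemma upper_0: "upper 0 = UNIV"
  by (auto simp: upper_def)

lemma shift_upper: "v \<in> upper j \<Longrightarrow> A v - scale (\<theta> j) v \<in> upper (Suc j)"
  by (auto simp: upper_def E_rules E_A less_Suc_eq)

lemma shift_lower: "0 < j \<Longrightarrow> v \<in> lower j \<Longrightarrow> A v - scale (\<theta> j) v \<in> lower (j - 1)"
  by (auto simp: lower_def E_rules E_A) (metis Suc_leI Suc_pred le_neq_implies_less)

lemma eigen_lower_0:
  assumes "v \<in> lower 0"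
  shows "A v = scale (\<theta> 0) v"
proof (rule eq_by_coordinates)
  fix h assume "h \<le> d"
  then show "E h (A v) = E h (scale (\<theta> 0) v)"
    using assms by (cases "h = 0") (auto simp: lower_def E_A E_rules)
qed

lemma reversed: "spectral_resolution scale A (\<lambda>i. E (d - i)) (\<lambda>i. \<theta> (d - i)) d"
proof -
  have "(\<Sum>i\<le>d. E (d - i) v) = v" for v
    using sum.nat_diff_reindex[of "\<lambda>i. E i v" "Suc d"] sum_E[of v]
    by (simp add: lessThan_Suc_atMost)
  moreover have "inj_on (\<lambda>i. \<theta> (d - i)) {..d}"
    using inj_eigenvalues by (fastforce simp: inj_on_def)
  ultimately show ?thesis
    using vector_space_axioms
    by (auto simp: spectral_resolution_def spectral_resolution_axioms_def linear_A linear_E E_E E_A)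
qed

end

text \<open>
  This is \<open>\<tau>\<^bsub>ij\<^esub>\<close> for \<open>i \<le> j\<close>, with the list of eigenvalues as an argument: below it is used for \<open>\<theta>\<close>, for
  the reversed list, and for \<open>\<theta>*\<close>.
\<close>

definition newton :: "(nat \<Rightarrow> 'k::field) \<Rightarrow> nat \<Rightarrow> nat \<Rightarrow> 'k poly" where
  "newton \<theta> i j = (\<Prod>h\<in>{i..<j}. [:- \<theta> h, 1:])"

lemma newton_same: "newton \<theta> i i = 1"
  by (simp add: newton_def)

lemma newton_Suc: "i \<le> j \<Longrightarrow> newton \<theta> i (Suc j) = [:- \<theta> j, 1:] * newton \<theta> i j"
  by (simp add: newton_def atLeastLessThanSuc)

lemma newton_first: "i < j \<Longrightarrow> newton \<theta> i j = [:- \<theta> i, 1:] * newton \<theta> (Suc i) j"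
  by (simp add: newton_def prod.atLeast_Suc_lessThan)

lemma newton_mult: "i \<le> j \<Longrightarrow> j \<le> k \<Longrightarrow> newton \<theta> j k * newton \<theta> i j = newton \<theta> i k"
  unfolding newton_def by (subst mult.commute) (rule prod.atLeastLessThan_concat)

lemma poly_newton: "poly (newton \<theta> i j) x = (\<Prod>h\<in>{i..<j}. x - \<theta> h)"
  by (simp add: newton_def poly_prod)

lemma poly_newton_root: "i \<le> h \<Longrightarrow> h < j \<Longrightarrow> poly (newton \<theta> i j) (\<theta> h) = 0"
  by (force simp: poly_newton)

lemma poly_newton_nonroot:
  assumes "inj_on \<theta> {..d}" "h \<le> d" "j \<le> Suc d" "h < i \<or> j \<le> h"
  shows "poly (newton \<theta> i j) (\<theta> h) \<noteq> 0"
proof -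
  have "\<theta> h \<noteq> \<theta> a" if "a \<in> {i..<j}" for a
    using inj_onD[OF assms(1), of h a] assms(2-4) that by auto
  then show ?thesis by (simp add: poly_newton)
qed

context spectral_resolution
begin

lemma at_A_linear_factor: "at_A [:- c, 1:] v = A v - scale c v"
  by (rule eq_by_coordinates) (simp add: E_at_A E_A E_rules algebra_simps)

lemma at_A_1: "at_A 1 v = v"
  by (rule eq_by_coordinates) (simp add: E_at_A)

lemma at_A_newton_Suc:
  "A (at_A (newton t i (i + j)) v)
    = at_A (newton t i (i + Suc j)) v + scale (t (i + j)) (at_A (newton t i (i + j)) v)"
  by (simp only: add_Suc_right newton_Suc le_add1 at_A_mult at_A_linear_factor diff_add_cancel)

text \<open>
  The Newton polynomials are triangular with respect to evaluation at the \<open>\<theta>\<^sub>i\<close>, with nonzero diagonal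
  entries because the \<open>\<theta>\<^sub>i\<close> are distinct.
\<close>

lemma newton_interpolation:
  "m \<le> d \<Longrightarrow> \<exists>x. \<forall>i\<le>m. f i = (\<Sum>j\<le>m. x j * poly (newton \<theta> 0 j) (\<theta> i))"
proof (induction m)
  case 0
  show ?case by (auto simp: newton_same)
next
  case (Suc m)
  then obtain x where x: "\<And>i. i \<le> m \<Longrightarrow> f i = (\<Sum>j\<le>m. x j * poly (newton \<theta> 0 j) (\<theta> i))" by auto
  define c where "c = poly (newton \<theta> 0 (Suc m)) (\<theta> (Suc m))"
  have c: "c \<noteq> 0"
    unfolding c_def using poly_newton_nonroot[OF inj_eigenvalues] Suc.prems by simp
  define y where
    "y = x(Suc m := (f (Suc m) - (\<Sum>j\<le>m. x j * poly (newton \<theta> 0 j) (\<theta> (Suc m)))) / c)"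
  have old: "(\<Sum>j\<le>m. y j * poly (newton \<theta> 0 j) z) = (\<Sum>j\<le>m. x j * poly (newton \<theta> 0 j) z)" for z
    by (rule sum.cong) (auto simp: y_def)
  have "f i = (\<Sum>j\<le>Suc m. y j * poly (newton \<theta> 0 j) (\<theta> i))" if "i \<le> Suc m" for i
  proof (cases "i = Suc m")
    case True
    then show ?thesis using c by (simp add: old) (simp add: y_def c_def)
  next
    case False
    then show ?thesis using that x[of i] by (simp add: old poly_newton_root)
  qed
  then show ?case by blast
qed

end

section \<open>The split decomposition\<close>

text \<open>
  A tridiagonal system in coordinates.  The assumptions are invariant under exchanging \<open>A\<close> with \<open>As\<close>
  and under reversing the order of the eigenspaces of \<open>A\<close>; each statement below is thus available in
  several orientations through \<open>swapped\<close> and \<open>reversed\<close>.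
\<close>

locale tridiagonal_setting =
  finite_dimensional_vector_space scale Basis +
  A: spectral_resolution scale A E \<theta> d +
  S: spectral_resolution scale As Es \<theta>s d
  for scale :: "'k::field \<Rightarrow> 'v::ab_group_add \<Rightarrow> 'v" and Basis A E \<theta> As Es \<theta>s d +
  assumes tridiagonal: "h \<le> d \<Longrightarrow> k \<le> d \<Longrightarrow> Suc k < h \<or> Suc h < k \<Longrightarrow> E h (As (E k v)) = 0"
    and tridiagonal_star: "h \<le> d \<Longrightarrow> k \<le> d \<Longrightarrow> Suc k < h \<or> Suc h < k \<Longrightarrow> Es h (A (Es k v)) = 0"
    and irreducible: "subspace W \<Longrightarrow> A ` W \<subseteq> W \<Longrightarrow> As ` W \<subseteq> W \<Longrightarrow> W = {0} \<or> W = UNIV"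
    and E_nonzero: "i \<le> d \<Longrightarrow> \<exists>v. E i v \<noteq> 0"
    and Es_nonzero: "i \<le> d \<Longrightarrow> \<exists>v. Es i v \<noteq> 0"
begin

lemma swapped: "tridiagonal_setting scale Basis As Es \<theta>s A E \<theta> d"
  by unfold_locales
    (rule tridiagonal_star tridiagonal irreducible Es_nonzero E_nonzero; assumption)+

lemma reversed: "tridiagonal_setting scale Basis A (\<lambda>i. E (d - i)) (\<lambda>i. \<theta> (d - i)) As Es \<theta>s d"
proof -
  interpret R: spectral_resolution scale A "\<lambda>i. E (d - i)" "\<lambda>i. \<theta> (d - i)" d
    by (rule A.reversed)
  show ?thesis
  proof unfold_locales
    fix h k v assume "h \<le> d" "k \<le> d" "Suc k < h \<or> Suc h < k"
    then show "E (d - h) (As (E (d - k) v)) = 0"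
      by (intro tridiagonal) auto
  qed (rule tridiagonal_star irreducible Es_nonzero E_nonzero; simp)+
qed

lemma A_lower:
  assumes "v \<in> S.lower i"
  shows "A v \<in> S.lower (Suc i)"
  unfolding S.lower_def
proof (clarify)
  fix h assume h: "h \<le> d" "Suc i < h"
  have "Es h (A v) = Es h (A (\<Sum>k\<le>d. Es k v))" by (simp add: S.sum_E)
  also have "\<dots> = (\<Sum>k\<le>d. Es h (A (Es k v)))" using h by (simp add: A.A_rules S.E_rules)
  also have "\<dots> = 0"
  proof (rule sum.neutral, clarify)
    fix k assume "k \<le> d"
    then show "Es h (A (Es k v)) = 0"
      using h assms tridiagonal_star[of h k]
      by (cases "k \<le> i") (auto simp: S.lower_def A.A_rules S.E_rules)
  qed
  finally show "Es h (A v) = 0" .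
qed

lemma As_upper:
  assumes "v \<in> A.upper i"
  shows "As v \<in> A.upper (i - 1)"
  unfolding A.upper_def
proof (clarify)
  fix h assume h: "h \<le> d" "h < i - 1"
  have "E h (As v) = E h (As (\<Sum>k\<le>d. E k v))" by (simp add: A.sum_E)
  also have "\<dots> = (\<Sum>k\<le>d. E h (As (E k v)))" using h by (simp add: S.A_rules A.E_rules)
  also have "\<dots> = 0"
  proof (rule sum.neutral, clarify)
    fix k assume "k \<le> d"
    then show "E h (As (E k v)) = 0"
    proof (cases "k < i")
      case True
      then show ?thesis
        using h assms \<open>k \<le> d\<close> by (simp add: A.upper_def S.A_rules A.E_rules)
    next
      case False
      then have "Suc h < k" using h by simp
      then show ?thesis using h \<open>k \<le> d\<close> tridiagonal by blast
    qed
  qed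
  finally show "E h (As v) = 0" .
qed

text \<open>
  \<open>corner i i\<close> is the component \<open>U\<^sub>i\<close> of the split decomposition.  The corners with \<open>i < j\<close> turn
  out to vanish, and this is what makes the components independent.
\<close>

definition corner :: "nat \<Rightarrow> nat \<Rightarrow> 'v set" where
  "corner i j = S.lower i \<inter> A.upper j"

lemma subspace_corner: "subspace (corner i j)"
  by (simp add: corner_def subspace_inter A.subspace_upper S.subspace_lower)

lemma raise_corner:
  assumes "v \<in> corner i j"
  shows "A v - scale (\<theta> j) v \<in> corner (Suc i) (Suc j)"
proof -
  have "v \<in> S.lower (Suc i)" using assms S.lower_mono[of i "Suc i"] by (auto simp: corner_def)
  then show ?thesis
    using assms A_lower A.shift_upper S.subspace_lower[of "Suc i"]
    by (auto simp: corner_def intro!: subspace_diff subspace_scale)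
qed

lemma descend_corner:
  assumes "v \<in> corner i j" "0 < i"
  shows "As v - scale (\<theta>s i) v \<in> corner (i - 1) (j - 1)"
proof -
  have "v \<in> A.upper (j - 1)" using assms A.upper_mono[of "j - 1" j] by (auto simp: corner_def)
  then show ?thesis
    using assms As_upper S.shift_lower A.subspace_upper[of "j - 1"]
    by (auto simp: corner_def intro!: subspace_diff subspace_scale)
qed

text \<open>
  Along a fixed diagonal, \<open>A\<close> moves a corner into itself and its successor, \<open>As\<close> into itself and its
  predecessor, so the span of the diagonal is invariant under both maps.
\<close>

lemma span_corners_trivial:
  "span (\<Union>i. corner i (i + r)) = {0} \<or> span (\<Union>i. corner i (i + r)) = UNIV"
    (is "?W = _ \<or> _")
proof (rule irreducible)
  show "subspace ?W" by simp
  have base: "v \<in> ?W" if "v \<in> corner i (i + r)" for v i using that by (auto intro: span_base)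
  show "A ` ?W \<subseteq> ?W"
  proof clarify
    fix x assume "x \<in> ?W"
    then show "A x \<in> ?W"
    proof (rule linear_maps_span[OF A.linear_A subspace_span])
      fix v assume "v \<in> (\<Union>i. corner i (i + r))"
      then obtain i where v: "v \<in> corner i (i + r)" by blast
      have "(A v - scale (\<theta> (i + r)) v) + scale (\<theta> (i + r)) v \<in> ?W"
        using base[of _ "Suc i"] base[OF v] raise_corner[OF v] by (intro span_add span_scale) auto
      then show "A v \<in> ?W" by simp
    qed
  qed
  show "As ` ?W \<subseteq> ?W"
  proof clarify
    fix x assume "x \<in> ?W"
    then show "As x \<in> ?W"
    proof (rule linear_maps_span[OF S.linear_A subspace_span])
      fix v assume "v \<in> (\<Union>i. corner i (i + r))"
      then obtain i where v: "v \<in> corner i (i + r)" by blast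
      show "As v \<in> ?W"
      proof (cases "i = 0")
        case True
        then show ?thesis
          using v base[OF v] S.eigen_lower_0[of v] by (auto simp: corner_def intro: span_scale)
      next
        case False
        then have "(As v - scale (\<theta>s i) v) + scale (\<theta>s i) v \<in> ?W"
          using base[of _ "i - 1"] base[OF v] descend_corner[OF v]
          by (intro span_add span_scale) auto
        then show ?thesis by simp
      qed
    qed
  qed
qed

text \<open>
  The diagonal at distance \<open>j - i > 0\<close> lies in a proper sum of eigenspaces of \<open>A\<close>, hence does not
  span everything.
\<close>

lemma corner_trivial:
  assumes "i < j" "v \<in> S.lower i" "v \<in> A.upper j"
  shows "v = 0"
proof -
  define r where "r = j - i"
  have r: "0 < r" "j = i + r" using assms by (auto simp: r_def)
  let ?W = "span (\<Union>i. corner i (i + r))"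
  have "?W \<subseteq> A.upper r"
    by (rule span_minimal[OF _ A.subspace_upper]) (auto simp: corner_def A.upper_def)
  moreover obtain w where "E 0 w \<noteq> 0" using E_nonzero by blast
  then have "E 0 w \<notin> A.upper r" using r by (auto simp: A.upper_def A.E_E)
  ultimately have "?W = {0}" using span_corners_trivial[of r] by blast
  moreover have "v \<in> ?W" using assms r by (auto simp: corner_def intro!: span_base)
  ultimately show ?thesis by blast
qed

lemma corners_span: "span (\<Union>i. corner i i) = UNIV"
proof -
  obtain w where w: "Es 0 w \<noteq> 0" using Es_nonzero by blast
  then have "Es 0 w \<in> corner 0 0" by (auto simp: corner_def S.lower_def S.E_E A.upper_0)
  then have "Es 0 w \<in> span (\<Union>i. corner i i)" by (auto intro: span_base)
  then have "span (\<Union>i. corner i i) \<noteq> {0}" using w by blast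
  then show ?thesis using span_corners_trivial[of 0] unfolding add_0_right by blast
qed

text \<open>
  Split \<open>v\<close> along the \<open>U\<^sub>i\<close> into a part with indices below \<open>j\<close> and a part with indices from \<open>j\<close> on.  The
  former lies in \<open>S.lower (j - 1)\<close>, and in \<open>A.upper j\<close> as a difference, so it is zero.
\<close>

lemma upper_in_span_corners:
  assumes v: "v \<in> A.upper j"
  shows "v \<in> span (\<Union>i\<in>{j..}. corner i i)"
proof -
  have "v \<in> span ((\<Union>i\<in>{..<j}. corner i i) \<union> (\<Union>i\<in>{j..}. corner i i))"
  proof -
    have "{..<j} \<union> {j..} = UNIV" by auto
    then show ?thesis using corners_span unfolding UN_Un[symmetric] by simp
  qed
  then obtain a b where ab: "v = a + b" "a \<in> span (\<Union>i\<in>{..<j}. corner i i)"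
      "b \<in> span (\<Union>i\<in>{j..}. corner i i)"
    unfolding span_Un by blast
  have "b \<in> A.upper j"
    by (rule span_le_subspace[OF ab(3) A.subspace_upper])
       (use A.upper_mono in \<open>auto simp: corner_def\<close>)
  then have "a \<in> A.upper j"
    using v subspace_diff[OF A.subspace_upper, of v j b] ab(1) by simp
  have "a = 0"
  proof (cases "j = 0")
    case True
    then show ?thesis using ab(2) by simp
  next
    case False
    have "(\<Union>i\<in>{..<j}. corner i i) \<subseteq> S.lower (j - 1)"
      by (auto simp: corner_def S.lower_def)
    then have "a \<in> S.lower (j - 1)"
      using span_le_subspace[OF ab(2) S.subspace_lower] by blast
    then show ?thesis using corner_trivial[of "j - 1" j a] False \<open>a \<in> A.upper j\<close> by simp
  qed
  then show ?thesis using ab(1,3) by (metis add_0_left)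
qed

end

section \<open>Raising and lowering between split components\<close>

context tridiagonal_setting
begin

lemma corner_trivial_reversed:
  assumes "i + j \<le> d" "v \<in> S.lower i" "\<And>h. j \<le> h \<Longrightarrow> h \<le> d \<Longrightarrow> E h v = 0"
  shows "v = 0"
proof (rule tridiagonal_setting.corner_trivial[OF reversed, of i "Suc (d - j)"])
  show "v \<in> spectral_resolution.upper (\<lambda>i. E (d - i)) d (Suc (d - j))"
    unfolding spectral_resolution.upper_def[OF A.reversed] using assms(1,3) by auto
qed (use assms in auto)

lemma raise_newton:
  assumes "i \<le> j" and v: "v \<in> corner i i"
  shows "A.at_A (newton \<theta> i j) v \<in> corner j j"
  using \<open>i \<le> j\<close>
proof (induction j rule: dec_induct)
  case base
  then show ?case using v by (simp add: newton_same A.at_A_1)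
next
  case (step j)
  then show ?case
    using raise_corner[OF step.IH] by (simp only: newton_Suc A.at_A_mult A.at_A_linear_factor)
qed

lemma descend_newton:
  assumes "j \<le> i" and v: "v \<in> corner i i"
  shows "S.at_A (newton \<theta>s (Suc j) (Suc i)) v \<in> corner j j"
  using \<open>j \<le> i\<close>
proof (induction j rule: inc_induct)
  case base
  then show ?case using v by (simp add: newton_same S.at_A_1)
next
  case (step j)
  then show ?case
    using descend_corner[OF step.IH]
    by (simp add: newton_first[of "Suc j"] S.at_A_mult S.at_A_linear_factor del: mult_pCons_left)
qed

text \<open>
  A vector in the kernel of \<open>\<tau>\<^bsub>ij\<^esub>(A)\<close> has components only in \<open>V\<^sub>i, \<dots>, V\<^bsub>j-1\<^esub>\<close>.  Seen from the other end of
  the list of eigenspaces it lies too far from \<open>V*\<^sub>0 + \<dots> + V*\<^sub>i\<close> to be nonzero.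
\<close>

lemma raise_newton_injective:
  assumes "i + j \<le> d" and v: "v \<in> corner i i" and 0: "A.at_A (newton \<theta> i j) v = 0"
  shows "v = 0"
proof (rule corner_trivial_reversed[OF assms(1)])
  show "v \<in> S.lower i" using v by (simp add: corner_def)
  fix h assume h: "j \<le> h" "h \<le> d"
  have "scale (poly (newton \<theta> i j) (\<theta> h)) (E h v) = 0"
    using 0 h A.E_at_A[of h "newton \<theta> i j" v] by (simp add: A.E_rules)
  moreover have "poly (newton \<theta> i j) (\<theta> h) \<noteq> 0"
    using poly_newton_nonroot[OF A.inj_eigenvalues] h assms(1) by simp
  ultimately show "E h v = 0" by simp
qed

text \<open>
  The mirror image of \<open>raise_newton_injective\<close> for the lowering map from \<open>U\<^bsub>d-i\<^esub>\<close> to \<open>U\<^sub>i\<close> given by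
  \<open>(A* - \<theta>*\<^bsub>i+1\<^esub>) \<dots> (A* - \<theta>*\<^bsub>d-i\<^esub>)\<close>.
\<close>

lemma descend_newton_injective:
  assumes "i \<le> d" and v: "v \<in> corner (d - i) (d - i)"
    and 0: "S.at_A (newton \<theta>s (Suc i) (Suc (d - i))) v = 0"
  shows "v = 0"
proof (rule tridiagonal_setting.corner_trivial[OF tridiagonal_setting.swapped[OF reversed], of i "Suc i"])
  show "v \<in> spectral_resolution.lower (\<lambda>i. E (d - i)) d i"
    unfolding spectral_resolution.lower_def[OF A.reversed]
    using v assms(1) by (auto simp: corner_def A.upper_def)
  show "v \<in> S.upper (Suc i)"
    unfolding S.upper_def
  proof clarify
    fix h assume h: "h \<le> d" "h < Suc i"
    have "scale (poly (newton \<theta>s (Suc i) (Suc (d - i))) (\<theta>s h)) (Es h v) = 0"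
      using 0 h S.E_at_A[of h "newton \<theta>s (Suc i) (Suc (d - i))" v] by (simp add: S.E_rules)
    moreover have "poly (newton \<theta>s (Suc i) (Suc (d - i))) (\<theta>s h) \<noteq> 0"
      using poly_newton_nonroot[OF S.inj_eigenvalues] h by simp
    ultimately show "Es h v = 0" by simp
  qed
qed simp

text \<open>
  Lowering from \<open>U\<^bsub>d-i\<^esub>\<close> to \<open>U\<^sub>i\<close> and raising back is an injective endomorphism of a finite dimensional
  space, hence surjective; so every vector of \<open>U\<^bsub>d-i\<^esub>\<close> is a raised one.
\<close>

lemma raise_newton_surjective:
  assumes "2 * i \<le> d" and u: "u \<in> corner (d - i) (d - i)"
  obtains w where "w \<in> corner i i" "u = A.at_A (newton \<theta> i (d - i)) w"
proof -
  define f where "f = A.at_A (newton \<theta> i (d - i)) \<circ> S.at_A (newton \<theta>s (Suc i) (Suc (d - i)))"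
  have lower: "S.at_A (newton \<theta>s (Suc i) (Suc (d - i))) v \<in> corner i i"
    if "v \<in> corner (d - i) (d - i)" for v
    using descend_newton[of i "d - i" v] that assms(1) by simp
  have "f ` corner (d - i) (d - i) = corner (d - i) (d - i)"
  proof (rule endo_injective_on_subspace_surjective)
    show "Vector_Spaces.linear scale scale f"
      unfolding f_def by (rule Vector_Spaces.linear_compose[OF S.linear_at_A A.linear_at_A])
    show "f v \<in> corner (d - i) (d - i)" if "v \<in> corner (d - i) (d - i)" for v
      using raise_newton[of i "d - i"] lower[OF that] assms(1) by (simp add: f_def)
    show "v = 0" if "v \<in> corner (d - i) (d - i)" "f v = 0" for v
    proof -
      have "S.at_A (newton \<theta>s (Suc i) (Suc (d - i))) v = 0"
        using raise_newton_injective[of i "d - i"] lower[OF that(1)] that(2) assms(1)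
        by (simp add: f_def)
      then show ?thesis using descend_newton_injective[of i v] that(1) assms(1) by simp
    qed
  qed (rule subspace_corner)
  then obtain v where "v \<in> corner (d - i) (d - i)" "u = f v" using u by blast
  then show ?thesis using that[OF lower] by (simp add: f_def)
qed

text \<open>
  The components below \<open>i\<close> already vanish on \<open>corner i i\<close>, so this is the space \<open>K\<^sub>i\<close>: the part of \<open>U\<^sub>i\<close>
  killed by \<open>\<tau>\<^bsub>i,d-i+1\<^esub>(A)\<close>.
\<close>

definition K :: "nat \<Rightarrow> 'v set" where
  "K i = {v \<in> corner i i. \<forall>h\<le>d. d - i < h \<longrightarrow> E h v = 0}"

text \<open>
  In the lower half, \<open>\<tau>\<^bsub>j,d-j+1\<^esub>(A)\<close> maps \<open>U\<^sub>j\<close> into \<open>U\<^bsub>d-j+1\<^esub>\<close>, which \<open>\<tau>\<^bsub>j-1,d-j+1\<^esub>(A)\<close> already covers from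
  \<open>U\<^bsub>j-1\<^esub>\<close>.  Subtracting a vector raised from \<open>U\<^bsub>j-1\<^esub>\<close> therefore brings any element of \<open>U\<^sub>j\<close> into \<open>K\<^sub>j\<close>.  In the
  upper half, \<open>U\<^sub>j\<close> is raised from \<open>U\<^bsub>d-j\<^esub>\<close>.
\<close>

lemma corner_generated:
  "j \<le> d \<Longrightarrow> u \<in> corner j j \<Longrightarrow>
    u \<in> span {A.at_A (newton \<theta> i j) v | i v. v \<in> K i \<and> i \<le> j \<and> i + j \<le> d}"
    (is "_ \<Longrightarrow> _ \<Longrightarrow> u \<in> span (?G j)")
proof (induction j arbitrary: u rule: less_induct)
  case (less j)
  have transport: "A.at_A (newton \<theta> k j) w \<in> span (?G j)"
    if w: "w \<in> corner k k" and "k < j" "k + j \<le> d" for k w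
  proof (rule linear_maps_span[OF A.linear_at_A subspace_span])
    show "w \<in> span (?G k)" using less.IH[OF \<open>k < j\<close>, of w] w that less.prems by simp
    fix x assume "x \<in> ?G k"
    then obtain i v where x: "x = A.at_A (newton \<theta> i k) v" "v \<in> K i" "i \<le> k" by blast
    then have "A.at_A (newton \<theta> k j) x = A.at_A (newton \<theta> i j) v"
      using newton_mult[of i k j \<theta>] \<open>k < j\<close> by (simp flip: A.at_A_mult)
    then show "A.at_A (newton \<theta> k j) x \<in> span (?G j)"
      using x that by (intro span_base) force
  qed
  show ?case
  proof (cases "2 * j \<le> d")
    case False
    then have "2 * (d - j) \<le> d" and "d - (d - j) = j" using less.prems(1) by simp_all
    then obtain w where "w \<in> corner (d - j) (d - j)" "u = A.at_A (newton \<theta> (d - j) j) w"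
      using raise_newton_surjective[of "d - j" u] less.prems(2) by metis
    then show ?thesis using transport[of w "d - j"] False less.prems by simp
  next
    case small: True
    have "\<exists>w \<in> span (?G j) \<inter> corner j j. A.at_A (newton \<theta> j (Suc (d - j))) (u - w) = 0"
    proof (cases j)
      case 0
      have "A.at_A (newton \<theta> 0 (Suc d)) u = 0"
        by (rule A.eq_by_coordinates) (simp add: A.E_at_A A.E_rules poly_newton_root)
      then show ?thesis using 0 by (intro bexI[of _ 0]) (auto simp: span_zero subspace_0 subspace_corner)
    next
      case (Suc k)
      have dk: "Suc (d - j) = d - k" using small Suc by simp
      then have "A.at_A (newton \<theta> j (Suc (d - j))) u \<in> corner (d - k) (d - k)"
        using raise_newton[of j "Suc (d - j)" u] small less.prems by simp
      then obtain w where w: "w \<in> corner k k"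
          "A.at_A (newton \<theta> j (Suc (d - j))) u = A.at_A (newton \<theta> k (d - k)) w"
        using raise_newton_surjective[of k] small Suc by auto
      from dk have "newton \<theta> k (d - k) = newton \<theta> j (Suc (d - j)) * newton \<theta> k j"
        using newton_mult[of k j "d - k" \<theta>] small Suc by simp
      then have "A.at_A (newton \<theta> j (Suc (d - j))) (u - A.at_A (newton \<theta> k j) w) = 0"
        using w(2) by (simp add: A.at_A_rules A.at_A_mult)
      moreover have "A.at_A (newton \<theta> k j) w \<in> span (?G j)"
        using transport[OF w(1)] small Suc by simp
      moreover have "A.at_A (newton \<theta> k j) w \<in> corner j j"
        using raise_newton[of k j] w(1) Suc by simp
      ultimately show ?thesis by blast
    qed
    then obtain w where w: "w \<in> span (?G j)" "w \<in> corner j j"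
        "A.at_A (newton \<theta> j (Suc (d - j))) (u - w) = 0" by blast
    have "u - w \<in> K j"
      unfolding K_def
    proof (safe)
      show "u - w \<in> corner j j" using less.prems w(2) by (intro subspace_diff subspace_corner)
      fix h assume h: "h \<le> d" "d - j < h"
      have "scale (poly (newton \<theta> j (Suc (d - j))) (\<theta> h)) (E h (u - w)) = 0"
        using w(3) h A.E_at_A[of h "newton \<theta> j (Suc (d - j))" "u - w"] by (simp add: A.E_rules)
      moreover have "poly (newton \<theta> j (Suc (d - j))) (\<theta> h) \<noteq> 0"
        using poly_newton_nonroot[OF A.inj_eigenvalues] h by simp
      ultimately show "E h (u - w) = 0" by simp
    qed
    then have "A.at_A (newton \<theta> j j) (u - w) \<in> ?G j" using small by force
    then have "u - w \<in> span (?G j)" by (simp add: newton_same A.at_A_1 span_base)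
    then have "(u - w) + w \<in> span (?G j)" using w(1) by (rule span_add)
    then show ?thesis by simp
  qed
qed

text \<open>
  A map that sends each generator of \<open>U\<^sub>k\<close> to a multiple of a generator of \<open>U\<^bsub>k-1\<^esub>\<close> lowers the whole
  filtration by the spaces \<open>V\<^sub>j + \<dots> + V\<^sub>d\<close>.
\<close>

lemma lowering_shifts_upper:
  assumes lin: "Vector_Spaces.linear scale scale \<Psi>"
    and zero: "\<And>i v. 2 * i \<le> d \<Longrightarrow> v \<in> K i \<Longrightarrow> \<Psi> v = 0"
    and step: "\<And>i j v. i \<le> j \<Longrightarrow> i + Suc j \<le> d \<Longrightarrow> v \<in> K i \<Longrightarrow>
      \<exists>c. \<Psi> (A.at_A (newton \<theta> i (Suc j)) v) = scale c (A.at_A (newton \<theta> i j) v)"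
    and v: "v \<in> A.upper (Suc j)"
  shows "\<Psi> v \<in> A.upper j"
proof (rule linear_maps_span[OF lin A.subspace_upper upper_in_span_corners[OF v]])
  fix u assume "u \<in> (\<Union>i\<in>{Suc j..}. corner i i)"
  then obtain k where k: "Suc j \<le> k" "u \<in> corner k k" by blast
  show "\<Psi> u \<in> A.upper j"
  proof (cases "k \<le> d")
    case False
    then have "u = 0" using k(2) A.upper_beyond[of k u] by (simp add: corner_def)
    then show ?thesis using A.subspace_upper by (simp add: linear_rules[OF lin] subspace_0)
  next
    case True
    show ?thesis
    proof (rule linear_maps_span[OF lin A.subspace_upper corner_generated[OF True k(2)]])
      fix x assume "x \<in> {A.at_A (newton \<theta> i k) v | i v. v \<in> K i \<and> i \<le> k \<and> i + k \<le> d}"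
      then obtain i v where x: "x = A.at_A (newton \<theta> i k) v" "v \<in> K i" "i \<le> k" "i + k \<le> d"
        by blast
      show "\<Psi> x \<in> A.upper j"
      proof (cases "i = k")
        case True
        then show ?thesis
          using zero[of i v] x A.subspace_upper by (simp add: newton_same A.at_A_1 subspace_0)
      next
        case False
        then obtain m where m: "k = Suc m" "i \<le> m" using x(3) by (cases k) auto
        then obtain c where "\<Psi> x = scale c (A.at_A (newton \<theta> i m) v)"
          using step[of i m v] x by auto
        moreover have "A.at_A (newton \<theta> i m) v \<in> corner m m"
          using raise_newton[of i m v] m x(2) by (simp add: K_def)
        ultimately show ?thesis
          using A.upper_mono[of j m] k m A.subspace_upper
          by (auto simp: corner_def intro!: subspace_scale)
      qed
    qed
  qed
qed

end

section \<open>The cubic commutation relation\<close>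

context vector_space
begin

text \<open>
  Here \<open>p, a0, a1, a2\<close> are consecutive vectors of a chain on which \<open>A\<close> acts by
  \<open>A a\<^sub>j = a\<^bsub>j+1\<^esub> + t\<^sub>ja\<^sub>j\<close>.  Expanding the cubic expression on \<open>a0\<close>, the hypotheses \<open>Q\<close> and \<open>M\<close> are what makes
  the coefficients of \<open>p\<close> and \<open>a0\<close> agree on both sides; what remains is \<open>\<Psi> a2\<close> against a multiple of
  \<open>a1\<close>.  At the start of a chain there is no \<open>p\<close>, which is why everything about \<open>p\<close> is multiplied by
  \<open>s0\<close>: there \<open>s0 = 0\<close>.
\<close>

lemma cubic_commutator_step:
  assumes A: "Vector_Spaces.linear scale scale A" and P: "Vector_Spaces.linear scale scale \<Psi>"
    and A0: "A a0 = a1 + scale t0 a0" and A1: "A a1 = a2 + scale t1 a1"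
    and P0: "\<Psi> a0 = scale s0 p" and P1: "\<Psi> a1 = scale s1 a0"
    and Ap: "scale s0 (A p) = scale s0 (a0 + scale t p)"
    and Q: "s0 * (t ^ 2 - \<beta> * t * t0 + t0 ^ 2 - \<gamma> * (t + t0) - \<rho>) = 0"
    and s2: "s2 - \<beta> * s1 + s0 = \<kappa>"
    and M: "s0 * (t + t0) - \<beta> * (s0 + s1) * t0 + s1 * (t0 + t1) - \<gamma> * (s0 + s1) = \<kappa> * t0 + \<mu>"
  shows "\<Psi> a2 = scale s2 a1 \<longleftrightarrow>
    A (A (\<Psi> a0)) - scale \<beta> (A (\<Psi> (A a0))) + \<Psi> (A (A a0)) - scale \<gamma> (A (\<Psi> a0) + \<Psi> (A a0))
      - scale \<rho> (\<Psi> a0) = scale \<kappa> (A a0) + scale \<mu> a0"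
proof -
  note lin = linear_rules[OF A] linear_rules[OF P]
  have AP0: "A (\<Psi> a0) = scale s0 a0 + scale (s0 * t) p"
    by (simp add: P0 lin Ap scale_right_distrib)
  have "scale (s0 * t) (A p) = scale t (scale s0 (A p))" by (simp add: mult.commute)
  also have "\<dots> = scale (s0 * t) a0 + scale (s0 * t * t) p"
    by (simp add: Ap scale_right_distrib mult_ac)
  finally have AAP0: "A (A (\<Psi> a0)) =
      scale s0 a1 + scale (s0 * (t + t0)) a0 + scale (s0 * t ^ 2) p"
    by (simp add: AP0 lin A0 algebra_simps power2_eq_square)
  have PA0: "\<Psi> (A a0) = scale s1 a0 + scale (s0 * t0) p"
    by (simp add: A0 lin P0 P1 mult_ac)
  have APA0: "A (\<Psi> (A a0)) =
      scale s1 a1 + scale ((s0 + s1) * t0) a0 + scale (s0 * t * t0) p"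
  proof -
    have "scale (s0 * t0) (A p) = scale t0 (scale s0 (A p))" by (simp add: mult.commute)
    also have "\<dots> = scale (s0 * t0) a0 + scale (s0 * t * t0) p"
      by (simp add: Ap scale_right_distrib mult_ac)
    finally show ?thesis unfolding PA0 by (simp add: lin A0 algebra_simps)
  qed
  have PAA0: "\<Psi> (A (A a0)) =
      \<Psi> a2 + scale (s1 * (t0 + t1)) a0 + scale (s0 * t0 ^ 2) p"
    by (simp add: A0 A1 lin P0 P1 algebra_simps power2_eq_square)
  have "A (A (\<Psi> a0)) - scale \<beta> (A (\<Psi> (A a0))) + \<Psi> (A (A a0))
      - scale \<gamma> (A (\<Psi> a0) + \<Psi> (A a0)) - scale \<rho> (\<Psi> a0)
    = \<Psi> a2 + scale (s0 - \<beta> * s1) a1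
      + scale (s0 * (t + t0) - \<beta> * (s0 + s1) * t0 + s1 * (t0 + t1) - \<gamma> * (s0 + s1)) a0
      + scale (s0 * (t ^ 2 - \<beta> * t * t0 + t0 ^ 2 - \<gamma> * (t + t0) - \<rho>)) p"
    unfolding AAP0 APA0 PAA0 unfolding PA0 AP0 unfolding P0
    by (simp add: algebra_simps)
  also have "\<dots> = \<Psi> a2 - scale s2 a1 + (scale \<kappa> (A a0) + scale \<mu> a0)"
    unfolding Q M s2[symmetric] A0 by (simp add: algebra_simps)
  finally show ?thesis by simp
qed

text \<open>
  The chains \<open>a\<close> and \<open>b\<close> start at the same vector and use the eigenvalues \<open>t\<^sub>0, \<dots>, t\<^sub>n\<close> in opposite orders.
  Along \<open>a\<close> the lowering rule gives the cubic relation.  Being linear, the relation passes to the span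
  of \<open>a\<close>, which contains \<open>b\<close>; along \<open>b\<close> it determines \<open>\<Psi>\<close> recursively from its values on \<open>b\<^sub>0\<close> and \<open>b\<^sub>1\<close>.  The
  constants match because \<open>\<kappa>\<close> involves only \<open>s\<close>, while the two expressions for \<open>\<mu>\<close> differ by
  \<open>l (c\<^sub>0c\<^sub>1 - c\<^sub>1c\<^sub>0)\<close>, where \<open>c\<^sub>j = t\<^sub>j - t\<^bsub>n-j\<^esub>\<close>.
\<close>

lemma lowering_independent_of_direction:
  fixes a b :: "nat \<Rightarrow> 'b" and t s :: "nat \<Rightarrow> 'a"
  assumes A: "Vector_Spaces.linear scale scale A" and P: "Vector_Spaces.linear scale scale \<Psi>"
    and a: "\<And>j. A (a j) = a (Suc j) + scale (t j) (a j)"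
    and b: "\<And>j. j \<le> n \<Longrightarrow> A (b j) = b (Suc j) + scale (t (n - j)) (b j)"
    and ab: "b 0 = a 0"
    and s0: "s 0 = 0" and s_Suc: "\<And>j. j < n \<Longrightarrow> s (Suc j) = s j + l * (t j - t (n - j))"
    and quad: "\<And>j. j < n \<Longrightarrow> t j ^ 2 - \<beta> * t j * t (Suc j) + t (Suc j) ^ 2 - \<gamma> * (t j + t (Suc j)) = \<rho>"
    and rec: "\<And>j. j + 2 \<le> n \<Longrightarrow> t (j + 2) - \<beta> * t (j + 1) + t j = \<gamma>"
    and P0: "\<Psi> (a 0) = 0"
    and PSuc: "\<And>j. j < n \<Longrightarrow> \<Psi> (a (Suc j)) = scale (s (Suc j)) (a j)"
    and j: "j < n"
  shows "\<Psi> (b (Suc j)) = scale (s (Suc j)) (b j)"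
proof -
  \<comment> \<open>The values that the coefficients of \<open>a 1\<close> and \<open>a 0\<close> force in the relation on \<open>a 0\<close>.\<close>
  define \<kappa> where "\<kappa> = s 2 - \<beta> * s 1"
  define \<mu> where "\<mu> = s 1 * (t 0 + t 1 - \<gamma>) - s 2 * t 0"
  define \<Omega> where "\<Omega> v = A (A (\<Psi> v)) - scale \<beta> (A (\<Psi> (A v))) + \<Psi> (A (A v))
    - scale \<gamma> (A (\<Psi> v) + \<Psi> (A v)) - scale \<rho> (\<Psi> v)" for v
  define u where "u j = t (n - j)" for j
  note lin = linear_rules[OF A] linear_rules[OF P]
  have rec_u: "u (j + 2) - \<beta> * u (j + 1) + u j = \<gamma>" if "j + 2 \<le> n" for j
  proof -
    have "n - j = (n - (j + 2)) + 2" "n - (j + 1) = (n - (j + 2)) + 1" using that by auto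
    then show ?thesis using rec[of "n - (j + 2)"] that by (simp add: u_def algebra_simps)
  qed
  have quad_u: "u j ^ 2 - \<beta> * u j * u (Suc j) + u (Suc j) ^ 2 - \<gamma> * (u j + u (Suc j)) = \<rho>"
    if "j < n" for j
  proof -
    have "n - j = Suc (n - Suc j)" using that by auto
    then show ?thesis using quad[of "n - Suc j"] that by (simp add: u_def algebra_simps)
  qed
  have s2: "s (j + 2) - \<beta> * s (j + 1) + s j = \<kappa>" if "j + 2 \<le> n" for j
    using that
  proof (induction j)
    case 0
    then show ?case by (simp add: \<kappa>_def s0 numeral_2_eq_2)
  next
    case (Suc j)
    have "s (Suc j + 2) = s (j + 2) + l * (t (j + 2) - u (j + 2))"
      "s (Suc j + 1) = s (j + 1) + l * (t (j + 1) - u (j + 1))"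
      "s (j + 2) = s (j + 1) + l * (t (j + 1) - u (j + 1))"
      "s (j + 1) = s j + l * (t j - u j)"
      using s_Suc[of "j + 2"] s_Suc[of "j + 1"] s_Suc[of j] Suc.prems by (simp_all add: u_def)
    moreover have "t (j + 2) - \<beta> * t (j + 1) + t j = \<gamma>" "u (j + 2) - \<beta> * u (j + 1) + u j = \<gamma>"
      "s (j + 2) - \<beta> * s (j + 1) + s j = \<kappa>"
      using rec rec_u Suc by simp_all
    ultimately have "s (Suc j + 2) - \<beta> * s (Suc j + 1) + s (j + 1) = \<kappa>" by algebra
    then show ?case by simp
  qed
  \<comment> \<open>Both sides change by \<open>\<kappa> (q (j + 1) - q j)\<close> from \<open>j\<close> to \<open>j + 1\<close>.  At \<open>j = 0\<close> the truncated
    index \<open>j - 1\<close> only occurs with the factor \<open>s 0 = 0\<close>.\<close>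
  have M: "s j * (q (j - 1) + q j) - \<beta> * (s j + s (j + 1)) * q j + s (j + 1) * (q j + q (j + 1))
      - \<gamma> * (s j + s (j + 1)) = \<kappa> * q j + \<mu>"
    if q: "\<And>j. j + 2 \<le> n \<Longrightarrow> q (j + 2) - \<beta> * q (j + 1) + q j = \<gamma>"
      and \<mu>: "\<mu> = s 1 * (q 0 + q 1 - \<gamma>) - s 2 * q 0" and "j + 2 \<le> n" for q j
    using \<open>j + 2 \<le> n\<close>
  proof (induction j)
    case 0
    then show ?case by (simp add: \<kappa>_def \<mu> s0 algebra_simps)
  next
    case (Suc j)
    have "s j * (q (j + 1) - \<beta> * q j + q (j - 1) - \<gamma>) = 0"
      using q[of "j - 1"] Suc.prems s0 by (cases j) auto
    then show ?case
      using Suc s2[of j] q[of j] by (simp add: numeral_2_eq_2) algebra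
  qed
  have \<mu>_u: "\<mu> = s 1 * (u 0 + u 1 - \<gamma>) - s 2 * u 0" if "2 \<le> n"
  proof -
    have "s 1 = l * (t 0 - u 0)" "s 2 = s 1 + l * (t 1 - u 1)"
      using s_Suc[of 0] s_Suc[of 1] s0 that by (simp_all add: u_def numeral_2_eq_2)
    then show ?thesis unfolding \<mu>_def by algebra
  qed
  have step: "\<Psi> (c (j + 2)) = scale (s (j + 2)) (c (j + 1)) \<longleftrightarrow>
      \<Omega> (c j) = scale \<kappa> (A (c j)) + scale \<mu> (c j)"
    if c: "\<And>i. i \<le> n \<Longrightarrow> A (c i) = c (Suc i) + scale (q i) (c i)"
      and q: "\<And>j. j + 2 \<le> n \<Longrightarrow> q (j + 2) - \<beta> * q (j + 1) + q j = \<gamma>"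
      and Q: "\<And>j. j < n \<Longrightarrow> q j ^ 2 - \<beta> * q j * q (Suc j) + q (Suc j) ^ 2 - \<gamma> * (q j + q (Suc j)) = \<rho>"
      and \<mu>: "\<mu> = s 1 * (q 0 + q 1 - \<gamma>) - s 2 * q 0"
      and c0: "\<Psi> (c j) = scale (s j) (c (j - 1))" and c1: "\<Psi> (c (j + 1)) = scale (s (j + 1)) (c j)"
      and j: "j + 2 \<le> n" for c q j
    unfolding \<Omega>_def
  proof (rule cubic_commutator_step[OF A P _ _ c0 c1, where t = "q (j - 1)"])
    show "A (c j) = c (j + 1) + scale (q j) (c j)" using c[of j] j by simp
    show "A (c (j + 1)) = c (j + 2) + scale (q (j + 1)) (c (j + 1))" using c[of "j + 1"] j by simp
    show "scale (s j) (A (c (j - 1))) = scale (s j) (c j + scale (q (j - 1)) (c (j - 1)))"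
      using s0 c[of "j - 1"] j by (cases j) auto
    show "s j * (q (j - 1) ^ 2 - \<beta> * q (j - 1) * q j + q j ^ 2 - \<gamma> * (q (j - 1) + q j) - \<rho>) = 0"
      using s0 Q[of "j - 1"] j by (cases j) auto
    show "s (j + 2) - \<beta> * s (j + 1) + s j = \<kappa>" using s2 j by simp
  qed (use M[OF q \<mu> j] in simp)
  have \<Omega>_a: "\<Omega> (a j) = scale \<kappa> (A (a j)) + scale \<mu> (a j)" if "j + 2 \<le> n" for j
  proof -
    have "\<Psi> (a j) = scale (s j) (a (j - 1))" using PSuc[of "j - 1"] P0 s0 that by (cases j) auto
    moreover have "\<Psi> (a (j + 1)) = scale (s (j + 1)) (a j)"
      "\<Psi> (a (j + 2)) = scale (s (j + 2)) (a (j + 1))"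
      using PSuc[of j] PSuc[of "j + 1"] that by simp_all
    ultimately show ?thesis using step[of a t j] a rec quad \<mu>_def that by blast
  qed
  have b_span: "j \<le> n \<Longrightarrow> b j \<in> span (a ` {..j})" for j
  proof (induction j)
    case 0
    then show ?case by (simp add: ab span_base)
  next
    case (Suc j)
    have le: "span (a ` {..j}) \<subseteq> span (a ` {..Suc j})" by (rule span_mono) auto
    have "A (b j) \<in> span (a ` {..Suc j})"
    proof (rule linear_maps_span[OF A subspace_span])
      show "b j \<in> span (a ` {..j})" using Suc by simp
      fix v assume "v \<in> a ` {..j}"
      then obtain i where i: "v = a i" "i \<le> j" by blast
      then have "a i \<in> span (a ` {..Suc j})" "a (Suc i) \<in> span (a ` {..Suc j})"
        by (auto intro: span_base)
      then show "A v \<in> span (a ` {..Suc j})"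
        unfolding i(1) a by (intro span_add span_scale)
    qed
    moreover have "b (Suc j) = A (b j) - scale (t (n - j)) (b j)" using b[of j] Suc.prems by simp
    ultimately show ?case using Suc.IH Suc.prems le by (auto intro!: span_diff span_scale)
  qed
  have \<Omega>_b: "\<Omega> (b j) = scale \<kappa> (A (b j)) + scale \<mu> (b j)" if "j + 2 \<le> n" for j
  proof -
    have "subspace {v. \<Omega> v = scale \<kappa> (A v) + scale \<mu> v}"
    proof -
      have "\<Omega> 0 = 0" "\<Omega> (x + y) = \<Omega> x + \<Omega> y" "\<Omega> (scale c x) = scale c (\<Omega> x)" for x y c
        unfolding \<Omega>_def by (simp_all add: lin algebra_simps)
      then show ?thesis unfolding subspace_def by (auto simp: lin algebra_simps)
    qed
    moreover have "a ` {..j} \<subseteq> {v. \<Omega> v = scale \<kappa> (A v) + scale \<mu> v}"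
      using \<Omega>_a that by auto
    ultimately show ?thesis using span_le_subspace[OF b_span[of j]] that by auto
  qed
  have "j \<le> n \<Longrightarrow> \<Psi> (b j) = scale (s j) (b (j - 1))" for j
  proof (induction j rule: less_induct)
    case (less j)
    consider "j = 0" | "j = 1" | i where "j = i + 2" by (metis One_nat_def add_2_eq_Suc' not0_implies_Suc)
    then show ?case
    proof cases
      case 1
      then show ?thesis by (simp add: ab P0 s0)
    next
      case 2
      have "b 1 = a 1 + scale (t 0 - t n) (a 0)"
        using a[of 0] b[of 0] less.prems 2 by (simp add: ab algebra_simps)
      then show ?thesis using 2 PSuc[of 0] P0 less.prems by (simp add: lin ab)
    next
      case 3
      have "\<Psi> (b i) = scale (s i) (b (i - 1))" "\<Psi> (b (i + 1)) = scale (s (i + 1)) (b i)"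
        using less.IH[of i] less.IH[of "i + 1"] 3 less.prems by simp_all
      moreover have "\<mu> = s 1 * (u 0 + u 1 - \<gamma>) - s 2 * u 0" "i + 2 \<le> n"
        using \<mu>_u 3 less.prems by simp_all
      moreover have "A (b k) = b (Suc k) + scale (u k) (b k)" if "k \<le> n" for k
        using b that by (simp add: u_def)
      ultimately have "\<Psi> (b (i + 2)) = scale (s (i + 2)) (b (i + 1))"
        using step[of b u i] rec_u quad_u \<Omega>_b by blast
      then show ?thesis using 3 by simp
    qed
  qed
  from this[of "Suc j"] j show ?thesis by simp
qed

end

section \<open>The recurrence of the eigenvalues\<close>

context tridiagonal_setting
begin

text \<open>
  For \<open>X = \<Sum> f\<^sub>iE\<^sub>i\<close> the components of \<open>A\<^sup>2A*A - AA*A\<^sup>2\<close> and of \<open>XA* - A*X\<close> between \<open>V\<^sub>k\<close> and \<open>V\<^sub>h\<close> are those of \<open>A*\<close>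
  times \<open>\<theta>\<^sub>h\<theta>\<^sub>k(\<theta>\<^sub>h - \<theta>\<^sub>k)\<close> and \<open>f\<^sub>h - f\<^sub>k\<close>.  Since \<open>A*\<close> is tridiagonal, the two maps are equal as soon as
  these factors agree for neighbouring \<open>h\<close> and \<open>k\<close>, which a telescoping sum \<open>f\<close> achieves.  Interpolate
  \<open>f\<^sub>i = p(\<theta>\<^sub>i)\<close> in the Newton basis and apply the identity to \<open>v \<in> V*\<^sub>0\<close>.  The left side stays within
  \<open>V*\<^sub>0 + \<dots> + V*\<^sub>3\<close>, with \<open>V*\<^sub>3\<close>-component a nonzero multiple of that of \<open>A\<^sup>3v\<close>; comparing leading components
  shows that \<open>p\<close> has degree exactly three.  Dividing \<open>p(\<theta>\<^sub>i) - p(\<theta>\<^bsub>i+1\<^esub>) = \<theta>\<^sub>i\<theta>\<^bsub>i+1\<^esub>(\<theta>\<^sub>i - \<theta>\<^bsub>i+1\<^esub>)\<close> by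
  \<open>\<theta>\<^sub>i - \<theta>\<^bsub>i+1\<^esub>\<close> gives the relation.
\<close>

lemma eigenvalue_relation_of_diameter_ge_3:
  assumes d: "3 \<le> d"
  obtains \<alpha>0 \<alpha>1 \<alpha>2 where "\<alpha>0 \<noteq> 0"
    "\<And>i. i < d \<Longrightarrow> \<theta> i * \<theta> (Suc i) = \<alpha>0 * (\<theta> i ^ 2 + \<theta> i * \<theta> (Suc i) + \<theta> (Suc i) ^ 2)
      + \<alpha>1 * (\<theta> i + \<theta> (Suc i)) + \<alpha>2"
proof -
  define f where "f i = - (\<Sum>h<i. \<theta> h * \<theta> (Suc h) * (\<theta> h - \<theta> (Suc h)))" for i
  have f_diff: "f i - f (Suc i) = \<theta> i * \<theta> (Suc i) * (\<theta> i - \<theta> (Suc i))" for i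
    by (simp add: f_def)
  obtain x where x: "\<And>i. i \<le> d \<Longrightarrow> f i = (\<Sum>j\<le>d. x j * poly (newton \<theta> 0 j) (\<theta> i))"
    using A.newton_interpolation[of d f] by auto
  define X where "X u = (\<Sum>j\<le>d. scale (x j) (A.at_A (newton \<theta> 0 j) u))" for u
  have E_X: "E h (X u) = scale (f h) (E h u)" if "h \<le> d" for h u
    using that by (simp add: X_def A.E_rules A.E_at_A x scale_sum_left)
  have commutator: "A (A (As (A u))) - A (As (A (A u))) = X (As u) - As (X u)" for u
  proof (rule A.eq_by_coordinates)
    fix h assume h: "h \<le> d"
    have expand: "E h (As y) = (\<Sum>k\<le>d. E h (As (E k y)))" for y
    proof -
      have "E h (As y) = E h (As (\<Sum>k\<le>d. E k y))" by (simp add: A.sum_E)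
      then show ?thesis using h by (simp add: S.A_rules A.E_rules)
    qed
    have "E h (A (A (As (A u))) - A (As (A (A u))))
        = scale (\<theta> h ^ 2) (E h (As (A u))) - scale (\<theta> h) (E h (As (A (A u))))"
      using h by (simp add: A.E_rules A.E_A power2_eq_square)
    also have "\<dots> = (\<Sum>k\<le>d. scale (\<theta> h * \<theta> k * (\<theta> h - \<theta> k)) (E h (As (E k u))))"
      unfolding expand[of "A u"] expand[of "A (A u)"] scale_sum_right sum_subtractf[symmetric]
      by (rule sum.cong[OF refl])
         (use h in \<open>simp add: A.E_A S.A_rules A.E_rules algebra_simps power2_eq_square\<close>)
    also have "\<dots> = (\<Sum>k\<le>d. scale (f h - f k) (E h (As (E k u))))"
    proof (rule sum.cong[OF refl])
      fix k assume "k \<in> {..d}"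
      then consider "Suc k < h \<or> Suc h < k" | "h = k" | "h = Suc k" | "k = Suc h" by fastforce
      then show "scale (\<theta> h * \<theta> k * (\<theta> h - \<theta> k)) (E h (As (E k u)))
          = scale (f h - f k) (E h (As (E k u)))"
      proof cases
        case 1
        then show ?thesis using h \<open>k \<in> {..d}\<close> by (simp add: tridiagonal)
      next
        case 3
        then have "f h - f k = \<theta> h * \<theta> k * (\<theta> h - \<theta> k)"
          using f_diff[of k] by (simp add: algebra_simps)
        then show ?thesis by simp
      qed (simp_all add: f_diff)
    qed
    also have "\<dots> = scale (f h) (E h (As u)) - E h (As (X u))"
      unfolding expand[of u] expand[of "X u"] scale_sum_right sum_subtractf[symmetric]
      by (rule sum.cong[OF refl])
         (use h in \<open>simp add: E_X S.A_rules A.E_rules algebra_simps\<close>)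
    also have "\<dots> = E h (X (As u) - As (X u))"
      using h by (simp add: A.E_rules E_X)
    finally show "E h (A (A (As (A u))) - A (As (A (A u)))) = E h (X (As u) - As (X u))" .
  qed
  obtain v where v: "v \<noteq> 0" "v \<in> S.lower 0"
    using Es_nonzero[of 0] by (auto simp: S.lower_def S.E_E)
  define w where "w j = A.at_A (newton \<theta> 0 j) v" for j
  define L where "L = A (A (As (A v))) - A (As (A (A v)))"
  have w: "w j \<in> corner j j" for j
    unfolding w_def using raise_newton[of 0 j] v by (simp add: corner_def A.upper_0)
  have w_nonzero: "Es k (w k) \<noteq> 0" if "0 < k" "k \<le> d" for k
  proof
    assume "Es k (w k) = 0"
    then have "w k \<in> S.lower (k - 1)"
      using w[of k] that by (auto simp: corner_def S.lower_def)
         (metis Suc_leI Suc_pred le_neq_implies_less)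
    then have "w k = 0" using corner_trivial[of "k - 1" k "w k"] w[of k] that by (simp add: corner_def)
    then show False
      using raise_newton_injective[of 0 k v] v that by (simp add: w_def corner_def A.upper_0)
  qed
  have Es_L: "Es k L = scale (\<theta>s 0 - \<theta>s k) (scale (x k) (Es k (w k)))"
    if k: "k \<le> d" and top: "\<And>j. k < j \<Longrightarrow> j \<le> d \<Longrightarrow> x j = 0" for k
  proof -
    have "L = X (As v) - As (X v)" unfolding L_def by (rule commutator)
    moreover have "X (As v) = scale (\<theta>s 0) (X v)"
      by (simp add: X_def S.eigen_lower_0[OF v(2)] A.at_A_rules scale_sum_right mult.commute)
    moreover have "Es k (X v) = (\<Sum>j\<le>d. if j = k then scale (x k) (Es k (w k)) else 0)"
      unfolding X_def S.E_rules(6)[OF k]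
    proof (rule sum.cong[OF refl])
      fix j assume "j \<in> {..d}"
      then consider "j < k" | "j = k" | "k < j" "j \<le> d" by fastforce
      then show "Es k (scale (x j) (A.at_A (newton \<theta> 0 j) v))
          = (if j = k then scale (x k) (Es k (w k)) else 0)"
      proof cases
        case 1
        then have "Es k (w j) = 0" using w[of j] k by (simp add: corner_def S.lower_def)
        then show ?thesis using 1 k by (simp add: S.E_rules w_def)
      qed (use k top in \<open>simp_all add: S.E_rules w_def\<close>)
    qed
    then have "Es k (X v) = scale (x k) (Es k (w k))" using k by simp
    ultimately show ?thesis
      using k by (simp add: S.E_rules S.E_A scale_left_diff_distrib left_diff_distrib)
  qed
  have Av: "A v \<in> S.lower 1" and AAv: "A (A v) \<in> S.lower 2"
    using A_lower[OF v(2)] A_lower[of "A v" 1] by (simp_all add: numeral_2_eq_2)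
  have z: "A (A (As (A v) - scale (\<theta>s 1) (A v))) \<in> S.lower 2"
    using A_lower[OF A_lower[OF S.shift_lower[OF _ Av]]] by (simp add: numeral_2_eq_2)
  have z': "A (As (A (A v)) - scale (\<theta>s 2) (A (A v))) \<in> S.lower 2"
    using A_lower[OF S.shift_lower[OF _ AAv]] by (simp add: numeral_2_eq_2)
  define r where "r = A (A (A v))"
  have L: "L - scale (\<theta>s 1 - \<theta>s 2) r \<in> S.lower 2"
    using subspace_diff[OF S.subspace_lower z z'] by (simp add: L_def r_def A.A_rules algebra_simps)
  have "r \<in> S.lower 3" unfolding r_def using A_lower[OF AAv] by (simp add: numeral_3_eq_3)
  then have r0: "Es k r = 0" if "3 < k" "k \<le> d" for k using that by (simp add: S.lower_def)
  have Es_L': "Es k L = scale (\<theta>s 1 - \<theta>s 2) (Es k r)" if "2 < k" "k \<le> d" for k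
    using L that by (auto simp: S.lower_def S.E_rules)
  have s_distinct: "\<theta>s i \<noteq> \<theta>s j" if "i \<le> d" "j \<le> d" "i \<noteq> j" for i j
    using inj_onD[OF S.inj_eigenvalues, of i j] that by auto
  \<comment> \<open>Descending induction: once the coefficients above \<open>k\<close> vanish, \<open>Es_L\<close> isolates \<open>x k\<close>.\<close>
  have x_high: "x k = 0" if "3 < k" "k \<le> d" for k
    using that
  proof (induction "d - k" arbitrary: k rule: less_induct)
    case less
    have "Es k L = scale (\<theta>s 0 - \<theta>s k) (scale (x k) (Es k (w k)))"
      using less by (intro Es_L) auto
    then show ?case
      using Es_L'[of k] r0[of k] w_nonzero[of k] s_distinct[of 0 k] less.prems by simp
  qed
  have x3: "x 3 \<noteq> 0"
  proof
    assume 0: "x 3 = 0"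
    have "Es 3 L = scale (\<theta>s 0 - \<theta>s 3) (scale (x 3) (Es 3 (w 3)))"
      using d x_high by (intro Es_L) auto
    then have "Es 3 r = 0" using Es_L'[of 3] s_distinct[of 1 2] d 0 by simp
    moreover have "Es 3 (w 3) = Es 3 r"
    proof -
      have w_Suc: "w (Suc j) = A (w j) - scale (\<theta> j) (w j)" for j
        unfolding w_def by (simp only: newton_Suc le0 A.at_A_mult A.at_A_linear_factor)
      have w0: "w 0 = v" by (simp add: w_def newton_same A.at_A_1)
      have "Es 3 v = 0" "Es 3 (A v) = 0" "Es 3 (A (A v)) = 0"
        using v(2) Av AAv d by (simp_all add: S.lower_def)
      then show ?thesis
        using d by (simp add: w_Suc w0 numeral_3_eq_3 r_def S.E_rules A.A_rules)
    qed
    ultimately show False using w_nonzero[of 3] d by simp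
  qed
  have f_cubic: "f i = x 0 + x 1 * (\<theta> i - \<theta> 0) + x 2 * ((\<theta> i - \<theta> 0) * (\<theta> i - \<theta> 1))
      + x 3 * ((\<theta> i - \<theta> 0) * (\<theta> i - \<theta> 1) * (\<theta> i - \<theta> 2))" if "i \<le> d" for i
  proof -
    have "f i = (\<Sum>j\<le>3. x j * poly (newton \<theta> 0 j) (\<theta> i))"
      unfolding x[OF that] using d x_high by (intro sum.mono_neutral_right) auto
    also have "{..3::nat} = {0, 1, 2, 3}" by auto
    finally show ?thesis
      by (simp add: poly_newton numeral_2_eq_2 numeral_3_eq_3 atLeastLessThanSuc mult_ac)
  qed
  show ?thesis
  \<comment> \<open>The coefficients of the cubic in powers of the variable, from its Newton coefficients.\<close>
  proof (rule that[of "x 3" "x 2 - x 3 * (\<theta> 0 + \<theta> 1 + \<theta> 2)"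
        "x 1 - x 2 * (\<theta> 0 + \<theta> 1) + x 3 * (\<theta> 0 * \<theta> 1 + \<theta> 0 * \<theta> 2 + \<theta> 1 * \<theta> 2)"])
    show "x 3 \<noteq> 0" by fact
    fix i assume i: "i < d"
    let ?s = "\<theta> i" and ?t = "\<theta> (Suc i)"
    have "(?s - ?t) * (?s * ?t) = (?s - ?t) * (x 3 * (?s ^ 2 + ?s * ?t + ?t ^ 2)
        + (x 2 - x 3 * (\<theta> 0 + \<theta> 1 + \<theta> 2)) * (?s + ?t)
        + (x 1 - x 2 * (\<theta> 0 + \<theta> 1) + x 3 * (\<theta> 0 * \<theta> 1 + \<theta> 0 * \<theta> 2 + \<theta> 1 * \<theta> 2)))"
    proof -
      have "(?s - ?t) * (?s * ?t) = f i - f (Suc i)"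
        using f_diff[of i] by (simp add: mult_ac)
      then show ?thesis
        unfolding f_cubic[OF less_imp_le[OF i]] f_cubic[OF Suc_leI[OF i]]
        by (simp add: algebra_simps power2_eq_square)
    qed
    moreover have "?s \<noteq> ?t" using inj_onD[OF A.inj_eigenvalues, of i "Suc i"] i by auto
    ultimately show "?s * ?t = x 3 * (?s ^ 2 + ?s * ?t + ?t ^ 2)
        + (x 2 - x 3 * (\<theta> 0 + \<theta> 1 + \<theta> 2)) * (?s + ?t)
        + (x 1 - x 2 * (\<theta> 0 + \<theta> 1) + x 3 * (\<theta> 0 * \<theta> 1 + \<theta> 0 * \<theta> 2 + \<theta> 1 * \<theta> 2))"
      by simp
  qed
qed

text \<open>
  Subtracting consecutive instances of the quadratic relation and cancelling \<open>\<theta>\<^bsub>i+2\<^esub> - \<theta>\<^sub>i\<close> gives the linear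
  recurrence.  For diameter at most two there are at most two instances of the quadratic relation, and
  \<open>\<beta> = 0\<close>, \<open>\<gamma> = \<theta>\<^sub>0 + \<theta>\<^sub>2\<close> makes them agree.
\<close>

lemma eigenvalue_recurrence:
  obtains \<beta> \<gamma> \<rho> where
    "\<And>i. i < d \<Longrightarrow> \<theta> i ^ 2 - \<beta> * \<theta> i * \<theta> (Suc i) + \<theta> (Suc i) ^ 2 - \<gamma> * (\<theta> i + \<theta> (Suc i)) = \<rho>"
    "\<And>i. i + 2 \<le> d \<Longrightarrow> \<theta> (i + 2) - \<beta> * \<theta> (i + 1) + \<theta> i = \<gamma>"
proof -
  have "\<exists>\<beta> \<gamma> \<rho>. \<forall>i<d. \<theta> i ^ 2 - \<beta> * \<theta> i * \<theta> (Suc i) + \<theta> (Suc i) ^ 2 - \<gamma> * (\<theta> i + \<theta> (Suc i)) = \<rho>"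
  proof (cases "3 \<le> d")
    case True
    obtain a b c where a: "a \<noteq> 0" and abc: "\<And>i. i < d \<Longrightarrow> \<theta> i * \<theta> (Suc i) =
        a * (\<theta> i ^ 2 + \<theta> i * \<theta> (Suc i) + \<theta> (Suc i) ^ 2) + b * (\<theta> i + \<theta> (Suc i)) + c"
      by (rule eigenvalue_relation_of_diameter_ge_3[OF True]) blast
    have "\<theta> i ^ 2 - (inverse a - 1) * \<theta> i * \<theta> (Suc i) + \<theta> (Suc i) ^ 2
        - (- b * inverse a) * (\<theta> i + \<theta> (Suc i)) = - c * inverse a"
      if "i < d" for i
    proof -
      define x y e where "x = \<theta> i" and "y = \<theta> (Suc i)" and "e = inverse a"
      have "a * e = 1" using a by (simp add: e_def)
      moreover have "x * y = a * (x ^ 2 + x * y + y ^ 2) + b * (x + y) + c"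
        unfolding x_def y_def by (rule abc[OF that])
      ultimately have "x ^ 2 - (e - 1) * x * y + y ^ 2 - (- b * e) * (x + y) = - c * e"
        by algebra
      then show ?thesis unfolding x_def y_def e_def .
    qed
    then show ?thesis by blast
  next
    case False
    have "\<theta> i ^ 2 - 0 * \<theta> i * \<theta> (Suc i) + \<theta> (Suc i) ^ 2 - (\<theta> 0 + \<theta> 2) * (\<theta> i + \<theta> (Suc i))
        = \<theta> 0 ^ 2 + \<theta> 1 ^ 2 - (\<theta> 0 + \<theta> 2) * (\<theta> 0 + \<theta> 1)" if "i < d" for i
    proof -
      have "i = 0 \<or> i = 1" using that False by auto
      then show ?thesis by (auto simp: algebra_simps power2_eq_square numeral_2_eq_2)
    qed
    then show ?thesis by blast
  qed
  then obtain \<beta> \<gamma> \<rho> where q: "\<And>i. i < d \<Longrightarrow>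
      \<theta> i ^ 2 - \<beta> * \<theta> i * \<theta> (Suc i) + \<theta> (Suc i) ^ 2 - \<gamma> * (\<theta> i + \<theta> (Suc i)) = \<rho>" by blast
  have r: "\<theta> (i + 2) - \<beta> * \<theta> (i + 1) + \<theta> i = \<gamma>" if "i + 2 \<le> d" for i
  proof -
    have "(\<theta> (i + 2) - \<theta> i) * (\<theta> (i + 2) - \<beta> * \<theta> (i + 1) + \<theta> i - \<gamma>) = 0"
    proof -
      have "\<theta> i ^ 2 - \<beta> * \<theta> i * \<theta> (i + 1) + \<theta> (i + 1) ^ 2 - \<gamma> * (\<theta> i + \<theta> (i + 1)) = \<rho>"
        "\<theta> (i + 1) ^ 2 - \<beta> * \<theta> (i + 1) * \<theta> (i + 2) + \<theta> (i + 2) ^ 2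
          - \<gamma> * (\<theta> (i + 1) + \<theta> (i + 2)) = \<rho>"
        using q[of i] q[of "i + 1"] that by simp_all
      moreover have "(z - x) * (z - \<beta> * y + x - \<gamma>)
          = (y ^ 2 - \<beta> * y * z + z ^ 2 - \<gamma> * (y + z)) - (x ^ 2 - \<beta> * x * y + y ^ 2 - \<gamma> * (x + y))"
        for x y z :: 'k by (simp add: algebra_simps power2_eq_square)
      ultimately show ?thesis by (simp only: diff_self)
    qed
    moreover have "\<theta> (i + 2) \<noteq> \<theta> i"
      using inj_onD[OF A.inj_eigenvalues, of "i + 2" i] that by auto
    ultimately show ?thesis by simp
  qed
  show ?thesis by (rule that[OF q r])
qed

end

section \<open>Lowering maps act tridiagonally\<close>

context tridiagonal_setting
begin

text \<open>
  The eigenspaces \<open>V\<^sub>i, \<dots>, V\<^bsub>d-i\<^esub>\<close> that enter \<open>K\<^sub>i\<close> form a symmetric set of indices.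
\<close>

lemma K_reversed:
  "i \<le> d \<Longrightarrow> tridiagonal_setting.K (\<lambda>i. E (d - i)) Es d i = K i"
  unfolding tridiagonal_setting.K_def[OF reversed] K_def
    tridiagonal_setting.corner_def[OF reversed] corner_def
    spectral_resolution.upper_def[OF A.reversed] A.upper_def
proof safe
  fix x h
  assume i: "i \<le> d" and h: "h \<le> d"
  {
    assume "\<forall>h\<le>d. d - i < h \<longrightarrow> E (d - h) x = 0" "h < i"
    then show "E h x = 0" using i h by (auto dest!: spec[of _ "d - h"])
  next
    assume "\<forall>h\<le>d. h < i \<longrightarrow> E (d - h) x = 0" "d - i < h"
    then show "E h x = 0" using i h by (auto dest!: spec[of _ "d - h"])
  next
    assume "\<forall>h\<le>d. d - i < h \<longrightarrow> E h x = 0" "h < i"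
    then show "E (d - h) x = 0" using i h by auto
  next
    assume "\<forall>h\<le>d. h < i \<longrightarrow> E h x = 0" "d - i < h"
    then show "E (d - h) x = 0" using i h by auto
  }
qed

text \<open>
  The coefficients \<open>\<sigma>\<close> now matter: their increments are antisymmetric under \<open>j \<mapsto> d - j\<close>, which is what
  \<open>lowering_independent_of_direction\<close> needs in order to carry the rule over to the reversed system.
\<close>

lemma lowering_tridiagonal:
  assumes lin: "Vector_Spaces.linear scale scale \<Psi>"
    and zero: "\<And>i v. 2 * i \<le> d \<Longrightarrow> v \<in> K i \<Longrightarrow> \<Psi> v = 0"
    and step: "\<And>i j v. i + (i + Suc j) \<le> d \<Longrightarrow> v \<in> K i \<Longrightarrow>
      \<Psi> (A.at_A (newton \<theta> i (i + Suc j)) v)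
        = scale (\<sigma> (i + Suc j) - \<sigma> i) (A.at_A (newton \<theta> i (i + j)) v)"
    and \<sigma>: "\<And>j. j < d \<Longrightarrow> \<sigma> (Suc j) = \<sigma> j + l * (\<theta> j - \<theta> (d - j))"
    and "h \<le> d" "k \<le> d" "Suc k < h \<or> Suc h < k"
  shows "E h (\<Psi> (E k v)) = 0"
proof -
  obtain \<beta> \<gamma> \<rho> where
    quad: "\<And>i. i < d \<Longrightarrow> \<theta> i ^ 2 - \<beta> * \<theta> i * \<theta> (Suc i) + \<theta> (Suc i) ^ 2 - \<gamma> * (\<theta> i + \<theta> (Suc i)) = \<rho>"
    and rec: "\<And>i. i + 2 \<le> d \<Longrightarrow> \<theta> (i + 2) - \<beta> * \<theta> (i + 1) + \<theta> i = \<gamma>"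
    by (rule eigenvalue_recurrence) blast
  have up: "\<Psi> x \<in> A.upper j" if "x \<in> A.upper (Suc j)" for x j
  proof (rule lowering_shifts_upper[OF lin zero _ that])
    fix i j v assume "i \<le> j" "i + Suc j \<le> d" "v \<in> K i"
    then show "\<exists>c. \<Psi> (A.at_A (newton \<theta> i (Suc j)) v) = scale c (A.at_A (newton \<theta> i j) v)"
      using step[of i "j - i" v] by auto
  qed
  have step': "\<Psi> (A.at_A (newton (\<lambda>i. \<theta> (d - i)) i (i + Suc j)) v)
        = scale (\<sigma> (i + Suc j) - \<sigma> i) (A.at_A (newton (\<lambda>i. \<theta> (d - i)) i (i + j)) v)"
    if ij: "i + (i + Suc j) \<le> d" and v: "v \<in> K i" for i j v
  proof -
    \<comment> \<open>The chains through \<open>v\<close> see the eigenvalues \<open>\<theta>\<^sub>i, \<dots>, \<theta>\<^bsub>d-i\<^esub>\<close>, re-indexed from \<open>0\<close> to \<open>n\<close>.\<close>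
    define n where "n = d - 2 * i"
    define a where "a j = A.at_A (newton \<theta> i (i + j)) v" for j
    define b where "b j = A.at_A (newton (\<lambda>i. \<theta> (d - i)) i (i + j)) v" for j
    have "\<Psi> (b (Suc j)) = scale (\<sigma> (i + Suc j) - \<sigma> i) (b j)"
    proof (cases "j < n")
      case True
      show ?thesis
      proof (rule lowering_independent_of_direction[OF A.linear_A lin, where a = a and b = b
            and t = "\<lambda>j. \<theta> (i + j)" and n = n and s = "\<lambda>j. \<sigma> (i + j) - \<sigma> i" and l = l
            and \<beta> = \<beta> and \<gamma> = \<gamma> and \<rho> = \<rho>])
        show "A (a j) = a (Suc j) + scale (\<theta> (i + j)) (a j)" for j
          unfolding a_def by (rule A.at_A_newton_Suc)
        show "b 0 = a 0" by (simp add: a_def b_def newton_same)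
        show "\<Psi> (a 0) = 0" using zero[of i v] v ij by (simp add: a_def newton_same A.at_A_1)
        show "\<Psi> (a (Suc j)) = scale (\<sigma> (i + Suc j) - \<sigma> i) (a j)" if "j < n" for j
          unfolding a_def using that by (intro step v) (simp add: n_def)
        show "j < n" by fact
        show "\<theta> (i + j) ^ 2 - \<beta> * \<theta> (i + j) * \<theta> (i + Suc j) + \<theta> (i + Suc j) ^ 2
            - \<gamma> * (\<theta> (i + j) + \<theta> (i + Suc j)) = \<rho>" if "j < n" for j
          using quad[of "i + j"] that by (simp add: n_def)
        show "\<theta> (i + (j + 2)) - \<beta> * \<theta> (i + (j + 1)) + \<theta> (i + j) = \<gamma>" if "j + 2 \<le> n" for j
          using rec[of "i + j"] that by (simp add: n_def add.assoc)
      next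
        fix j assume j: "j < n"
        then have "i + (n - j) = d - (i + j)" by (simp add: n_def)
        then show "\<sigma> (i + Suc j) - \<sigma> i = \<sigma> (i + j) - \<sigma> i + l * (\<theta> (i + j) - \<theta> (i + (n - j)))"
          using \<sigma>[of "i + j"] j by (simp add: n_def)
      next
        show "A (b j) = b (Suc j) + scale (\<theta> (i + (n - j))) (b j)" if "j \<le> n" for j
        proof -
          have "i + (n - j) = d - (i + j)" using that ij by (simp add: n_def)
          then show ?thesis unfolding b_def by (simp only: A.at_A_newton_Suc)
        qed
      qed simp
    next
      case False
      then show ?thesis using ij by (simp add: n_def)
    qed
    then show ?thesis by (simp add: b_def)
  qed
  have down: "\<Psi> x \<in> spectral_resolution.upper (\<lambda>i. E (d - i)) d j"
    if "x \<in> spectral_resolution.upper (\<lambda>i. E (d - i)) d (Suc j)" for x j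
  proof (rule tridiagonal_setting.lowering_shifts_upper[OF reversed lin _ _ that])
    show "\<Psi> v = 0" if "2 * i \<le> d" "v \<in> tridiagonal_setting.K (\<lambda>i. E (d - i)) Es d i" for i v
      using that zero by (simp add: K_reversed)
    fix i j v assume "i \<le> j" "i + Suc j \<le> d" "v \<in> tridiagonal_setting.K (\<lambda>i. E (d - i)) Es d i"
    then show "\<exists>c. \<Psi> (A.at_A (newton (\<lambda>i. \<theta> (d - i)) i (Suc j)) v)
        = scale c (A.at_A (newton (\<lambda>i. \<theta> (d - i)) i j) v)"
      using step'[of i "j - i" v] by (auto simp: K_reversed)
  qed
  from assms(7) show ?thesis
  proof
    assume "Suc h < k"
    moreover from this have "E k v \<in> A.upper (Suc (k - 1))"
      using \<open>k \<le> d\<close> by (auto simp: A.upper_def A.E_E)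
    ultimately show ?thesis
      using up[of "E k v" "k - 1"] \<open>h \<le> d\<close> by (simp add: A.upper_def)
  next
    assume "Suc k < h"
    moreover from this have "E k v \<in> spectral_resolution.upper (\<lambda>i. E (d - i)) d (Suc (d - k - 1))"
      using \<open>h \<le> d\<close> by (auto simp: spectral_resolution.upper_def[OF A.reversed] A.E_E)
    ultimately have "\<Psi> (E k v) \<in> spectral_resolution.upper (\<lambda>i. E (d - i)) d (d - k - 1)"
      "d - h \<le> d" "d - h < d - k - 1"
      using down[of "E k v" "d - k - 1"] \<open>h \<le> d\<close> by auto
    then have "E (d - (d - h)) (\<Psi> (E k v)) = 0"
      unfolding spectral_resolution.upper_def[OF A.reversed] by blast
    then show ?thesis using \<open>h \<le> d\<close> by simp
  qed
qed

end

section \<open>Tridiagonal systems\<close>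

context spectral_resolution
begin

lemma range_coordinates: "k \<le> d \<Longrightarrow> v \<in> range (E k) \<longleftrightarrow> (\<forall>h\<le>d. h \<noteq> k \<longrightarrow> E h v = 0)"
proof
  assume k: "k \<le> d" and v: "\<forall>h\<le>d. h \<noteq> k \<longrightarrow> E h v = 0"
  have "E k v = v"
    by (rule eq_by_coordinates) (use k v in \<open>auto simp: E_E\<close>)
  then show "v \<in> range (E k)" by (metis rangeI)
qed (auto simp: E_E)

lemma sum_ranges:
  assumes "I \<subseteq> {..d}"
  shows "(\<Sum>h\<in>I. range (E h)) = {v. \<forall>h\<le>d. h \<notin> I \<longrightarrow> E h v = 0}"
proof safe
  have fin: "finite I" using assms finite_subset by blast
  fix v h assume "v \<in> (\<Sum>h\<in>I. range (E h))" and h: "h \<le> d" "h \<notin> I"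
  then obtain s where s: "v = sum s I" "\<forall>i\<in>I. s i \<in> range (E i)"
    using fin by (auto simp: set_sum_alt)
  have "E h (s i) = 0" if "i \<in> I" for i
    using that s(2) h assms range_coordinates[of i "s i"] by blast
  then show "E h v = 0" using h by (simp add: s(1) E_rules)
next
  have fin: "finite I" using assms finite_subset by blast
  fix v assume v: "\<forall>h\<le>d. h \<notin> I \<longrightarrow> E h v = 0"
  have "(\<Sum>h\<le>d. E h v) = (\<Sum>h\<in>I. E h v)"
    using assms v by (intro sum.mono_neutral_right) auto
  then have "v = (\<Sum>h\<in>I. E h v)" by (simp only: sum_E)
  then show "v \<in> (\<Sum>h\<in>I. range (E h))"
    unfolding set_sum_alt[OF fin] by blast
qed

lemma adjacent_sum_coordinates:
  assumes k: "k \<le> d"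
  shows "v \<in> adjacent_sum d (\<lambda>h. range (E h)) k
    \<longleftrightarrow> (\<forall>h\<le>d. Suc k < h \<or> Suc h < k \<longrightarrow> E h v = 0)"
proof -
  let ?Z = "zero_ext d (\<lambda>h. range (E h))"
  have Z: "?Z z = {v. \<forall>h\<le>d. int h \<noteq> z \<longrightarrow> E h v = 0}" for z
  proof (cases "0 \<le> z \<and> z \<le> int d")
    case True
    then obtain k where k: "z = int k" "k \<le> d" by (metis nat_0_le nat_le_iff)
    then have "?Z z = range (E k)" by (simp add: zero_ext_def)
    then show ?thesis using range_coordinates[OF k(2)] k by auto
  next
    case False
    have "v = 0" if v: "\<forall>h\<le>d. int h \<noteq> z \<longrightarrow> E h v = 0" for v
    proof (rule eq_by_coordinates)
      fix h assume "h \<le> d"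
      then show "E h v = E h 0" using v False by (auto simp: E_rules)
    qed
    moreover have "\<forall>h\<le>d. int h \<noteq> z \<longrightarrow> E h 0 = 0" by (simp add: E_rules)
    ultimately have "{v. \<forall>h\<le>d. int h \<noteq> z \<longrightarrow> E h v = 0} = {0}" by blast
    with False show ?thesis by (simp only: zero_ext_def if_False)
  qed
  show ?thesis
  proof
    assume "v \<in> adjacent_sum d (\<lambda>h. range (E h)) k"
    then obtain x y z where "v = x + y + z" "x \<in> ?Z (int k - 1)" "y \<in> ?Z (int k)" "z \<in> ?Z (int k + 1)"
      unfolding adjacent_sum_def by (auto elim!: set_plus_elim)
    then show "\<forall>h\<le>d. Suc k < h \<or> Suc h < k \<longrightarrow> E h v = 0"
      by (auto simp: Z E_rules)
  next
    assume far: "\<forall>h\<le>d. Suc k < h \<or> Suc h < k \<longrightarrow> E h v = 0"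
    define x y z where "x = (if k = 0 then 0 else E (k - 1) v)" and "y = E k v"
      and "z = (if k = d then 0 else E (Suc k) v)"
    have "v = x + y + z"
    proof (rule eq_by_coordinates)
      fix h assume h: "h \<le> d"
      then consider "Suc k < h \<or> Suc h < k" | "k = Suc h" | "k = h" | "h = Suc k" by linarith
      then show "E h v = E h (x + y + z)"
        by cases (use h k far in \<open>auto simp: x_def y_def z_def E_rules E_E\<close>)
    qed
    moreover have "x \<in> ?Z (int k - 1)" "y \<in> ?Z (int k)" "z \<in> ?Z (int k + 1)"
      using k by (auto simp: Z x_def y_def z_def E_E E_rules)
    ultimately show "v \<in> adjacent_sum d (\<lambda>h. range (E h)) k"
      unfolding adjacent_sum_def by blast
  qed
qed

end

context vector_space
begin

lemma subspace_eigenspace: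
  assumes "Vector_Spaces.linear scale scale A"
  shows "subspace (eigenspace scale A t)"
  unfolding eigenspace_def subspace_def by (auto simp: linear_rules[OF assms] algebra_simps)

lemma eigenspace_determines_eigenvalue:
  assumes "eigenspace scale A s = eigenspace scale A t" "eigenspace scale A s \<noteq> {0}"
    "Vector_Spaces.linear scale scale A"
  shows "s = t"
proof -
  have "0 \<in> eigenspace scale A s" using subspace_0[OF subspace_eigenspace[OF assms(3)]] .
  then obtain v where "v \<noteq> 0" "v \<in> eigenspace scale A s" using assms(2) by blast
  moreover from this have "v \<in> eigenspace scale A t" using assms(1) by simp
  ultimately have "scale s v = scale t v" "v \<noteq> 0" by (simp_all add: eigenspace_def)
  then show ?thesis by simp
qed

text \<open>
  A primitive idempotent is only known to be the identity on some eigenspace \<open>W\<close> and zero on the others.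
  As the eigenspaces span, its range is \<open>W\<close>, and so the idempotents and the eigenspaces are indexed
  consistently.
\<close>

lemma spectral_resolution_of_idempotents:
  assumes diag: "diagonalizable scale A"
    and E: "bij_betw E {..d} (primitive_idempotents scale A)"
    and R: "bij_betw (\<lambda>i. range (E i)) {..d} (eigenspaces scale A)"
  shows "spectral_resolution scale A E (theta scale A E) d"
proof -
  let ?\<theta> = "theta scale A E"
  have A: "Vector_Spaces.linear scale scale A" and span: "span (\<Union>(eigenspaces scale A)) = UNIV"
    using diag by (auto simp: diagonalizable_def)
  have prim: "E i \<in> primitive_idempotents scale A" if "i \<le> d" for i
    using E that by (auto simp: bij_betw_def)
  have lin: "Vector_Spaces.linear scale scale (E i)" if "i \<le> d" for i
    using prim[OF that] by (simp add: primitive_idempotents_def)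
  have R_eig: "range (E i) \<in> eigenspaces scale A" if "i \<le> d" for i
    using R that by (auto simp: bij_betw_def)
  have sub: "subspace W" if "W \<in> eigenspaces scale A" for W
    using that subspace_eigenspace[OF A] by (auto simp: eigenspaces_def)
  have proj: "(\<forall>v\<in>range (E i). E i v = v) \<and>
      (\<forall>W' \<in> eigenspaces scale A. W' \<noteq> range (E i) \<longrightarrow> (\<forall>v\<in>W'. E i v = 0))" if i: "i \<le> d" for i
  proof -
    obtain W where W: "W \<in> eigenspaces scale A" "\<And>v. v \<in> W \<Longrightarrow> E i v = v"
        "\<And>W' v. W' \<in> eigenspaces scale A \<Longrightarrow> W' \<noteq> W \<Longrightarrow> v \<in> W' \<Longrightarrow> E i v = 0"
      using prim[OF i] unfolding primitive_idempotents_def by blast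
    have "E i v \<in> W" for v
    proof (rule linear_maps_span[OF lin[OF i] sub[OF W(1)]])
      show "v \<in> span (\<Union>(eigenspaces scale A))" using span by simp
      show "E i v \<in> W" if "v \<in> \<Union>(eigenspaces scale A)" for v
        using that W subspace_0[OF sub[OF W(1)]] by (metis UnionE)
    qed
    moreover have "v \<in> range (E i)" if "v \<in> W" for v
      using W(2)[OF that] by (metis rangeI)
    ultimately have "range (E i) = W" by blast
    then show ?thesis using W by blast
  qed
  have E_E: "E i (E j v) = (if i = j then E j v else 0)" if "i \<le> d" "j \<le> d" for i j v
  proof (cases "i = j")
    case True
    then show ?thesis using proj[OF that(1)] by simp
  next
    case False
    then have "range (E j) \<noteq> range (E i)"
      using inj_onD[OF bij_betw_imp_inj_on[OF R], of j i] that by auto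
    then have "E i (E j v) = 0" using proj[OF that(1)] R_eig[OF that(2)] by blast
    then show ?thesis using False by simp
  qed
  have sum_E: "(\<Sum>i\<le>d. E i v) = v" for v
  proof -
    have "subspace {v. (\<Sum>i\<le>d. E i v) = v}"
      unfolding subspace_def
      by (auto simp: linear_rules[OF lin] sum.distrib scale_sum_right[symmetric])
    moreover have "\<Union>(eigenspaces scale A) \<subseteq> {v. (\<Sum>i\<le>d. E i v) = v}"
    proof clarify
      fix v W assume "W \<in> eigenspaces scale A" "v \<in> W"
      then obtain j w where j: "j \<le> d" "v = E j w"
        using bij_betw_imp_surj_on[OF R] by blast
      then have "(\<Sum>i\<le>d. E i v) = (\<Sum>i\<le>d. if i = j then v else 0)"
        by (intro sum.cong) (auto simp: E_E)
      then show "(\<Sum>i\<le>d. E i v) = v" using j by simp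
    qed
    ultimately have "v \<in> {v. (\<Sum>i\<le>d. E i v) = v}"
      using span_le_subspace[of v "\<Union>(eigenspaces scale A)"] span by blast
    then show ?thesis by simp
  qed
  have theta: "range (E i) = eigenspace scale A (?\<theta> i)" if i: "i \<le> d" for i
  proof -
    obtain t where t: "range (E i) = eigenspace scale A t" and "range (E i) \<noteq> {0}"
      using R_eig[OF i] by (auto simp: eigenspaces_def)
    then have "s = t" if "range (E i) = eigenspace scale A s" for s
      using eigenspace_determines_eigenvalue[OF _ _ A, of s t] that by simp
    with t show ?thesis
      unfolding theta_def by (rule theI[where P = "\<lambda>t. range (E i) = eigenspace scale A t"])
  qed
  have A_E: "A (E i v) = scale (?\<theta> i) (E i v)" if "i \<le> d" for i v
    using theta[OF that] by (auto simp: eigenspace_def)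
  have E_A: "E i (A v) = scale (?\<theta> i) (E i v)" if i: "i \<le> d" for i v
  proof -
    have "E i (A v) = E i (A (\<Sum>j\<le>d. E j v))" by (simp add: sum_E)
    also have "\<dots> = (\<Sum>j\<le>d. E i (A (E j v)))"
      by (simp only: linear_rules(6)[OF A] linear_rules(6)[OF lin[OF i]])
    also have "\<dots> = (\<Sum>j\<le>d. if j = i then scale (?\<theta> i) (E i v) else 0)"
    proof (rule sum.cong[OF refl])
      fix j assume "j \<in> {..d}"
      then show "E i (A (E j v)) = (if j = i then scale (?\<theta> i) (E i v) else 0)"
        using i by (simp add: A_E linear_rules(5)[OF lin] E_E)
    qed
    finally show ?thesis using i by simp
  qed
  have inj: "inj_on ?\<theta> {..d}"
  proof (rule inj_onI)
    fix i j assume "i \<in> {..d}" "j \<in> {..d}" "?\<theta> i = ?\<theta> j"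
    then show "i = j"
      using theta[of i] theta[of j] inj_onD[OF bij_betw_imp_inj_on[OF R], of i j] by simp
  qed
  show ?thesis
    unfolding spectral_resolution_def spectral_resolution_axioms_def
    by (intro conjI allI impI vector_space_axioms A lin E_E sum_E E_A inj)
qed

end

lemma td_system_setting:
  fixes scale :: "'k::field \<Rightarrow> 'v::ab_group_add \<Rightarrow> 'v"
  assumes fd: "finite_dimensional_vector_space scale Basis" and td: "td_system scale d A E As Es"
  shows "tridiagonal_setting scale Basis A E (theta scale A E) As Es (theta scale As Es) d"
proof -
  interpret finite_dimensional_vector_space scale Basis by fact
  have pair: "td_pair scale A As" using td unfolding td_system_def by blast
  have diag: "diagonalizable scale A" "diagonalizable scale As"
    and irreducible: "\<not> (\<exists>W. subspace W \<and> A ` W \<subseteq> W \<and> As ` W \<subseteq> W \<and> W \<noteq> {0} \<and> W \<noteq> UNIV)"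
    using pair unfolding td_pair_def by blast+
  have idem: "bij_betw E {..d} (primitive_idempotents scale A)"
    "bij_betw Es {..d} (primitive_idempotents scale As)"
    and std: "standard_ordering scale A As d (\<lambda>i. range (E i))"
    "standard_ordering scale As A d (\<lambda>i. range (Es i))"
    using td unfolding td_system_def by blast+
  have ranges: "bij_betw (\<lambda>i. range (E i)) {..d} (eigenspaces scale A)"
    "bij_betw (\<lambda>i. range (Es i)) {..d} (eigenspaces scale As)"
    using std unfolding standard_ordering_def by blast+
  interpret A: spectral_resolution scale A E "theta scale A E" d
    by (rule spectral_resolution_of_idempotents) fact+
  interpret S: spectral_resolution scale As Es "theta scale As Es" d
    by (rule spectral_resolution_of_idempotents) fact+
  have nonzero: "range (E i) \<noteq> {0}" "range (Es i) \<noteq> {0}" if "i \<le> d" for i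
    using bij_betwE[OF ranges(1)] bij_betwE[OF ranges(2)] that unfolding eigenspaces_def by blast+
  show ?thesis
  proof unfold_locales
    fix h k v assume hk: "h \<le> d" "k \<le> d" "Suc k < h \<or> Suc h < k"
    have "As (E k v) \<in> adjacent_sum d (\<lambda>h. range (E h)) k"
      using std(1) hk unfolding standard_ordering_def by blast
    then show "E h (As (E k v)) = 0" using A.adjacent_sum_coordinates hk by blast
    have "A (Es k v) \<in> adjacent_sum d (\<lambda>h. range (Es h)) k"
      using std(2) hk unfolding standard_ordering_def by blast
    then show "Es h (A (Es k v)) = 0" using S.adjacent_sum_coordinates hk by blast
  next
    show "W = {0} \<or> W = UNIV" if "subspace W" "A ` W \<subseteq> W" "As ` W \<subseteq> W" for W
      using irreducible that by blast
    fix i assume i: "i \<le> d"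
    have "\<exists>v. f v \<noteq> 0" if "range f \<noteq> {0}" for f :: "'v \<Rightarrow> 'v"
    proof (rule ccontr)
      assume "\<nexists>v. f v \<noteq> 0"
      then have "\<And>v. f v = 0" by blast
      then show False using that by simp
    qed
    then show "\<exists>v. E i v \<noteq> 0" "\<exists>v. Es i v \<noteq> 0" using nonzero[OF i] by blast+
  qed
qed

lemma (in tridiagonal_setting) K_eq_K_space:
  assumes "2 * i \<le> d"
  shows "K i = K_space d E Es i"
proof -
  have "(\<Sum>h\<in>{..i}. range (Es h)) = {v. \<forall>h\<le>d. h \<notin> {..i} \<longrightarrow> Es h v = 0}"
    by (rule S.sum_ranges) (use assms in auto)
  moreover have "(\<Sum>h\<in>{i..d - i}. range (E h)) = {v. \<forall>h\<le>d. h \<notin> {i..d - i} \<longrightarrow> E h v = 0}"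
    by (rule A.sum_ranges) auto
  moreover have "h \<notin> {..i} \<longleftrightarrow> i < h" "h \<notin> {i..d - i} \<longleftrightarrow> h < i \<or> d - i < h" for h by auto
  ultimately have "K_space d E Es i = {v. \<forall>h\<le>d. i < h \<longrightarrow> Es h v = 0}
      \<inter> {v. \<forall>h\<le>d. h < i \<or> d - i < h \<longrightarrow> E h v = 0}"
    by (simp only: K_space_def)
  then show ?thesis
    unfolding K_def corner_def S.lower_def A.upper_def by blast
qed

lemma tau_eq_newton:
  "i \<le> j \<Longrightarrow> tau \<theta> i (int j) = newton \<theta> i j"
  by (simp add: tau_def newton_def)

theorem corollary15p4:
  fixes scale :: "'k::field \<Rightarrow> 'v::ab_group_add \<Rightarrow> 'v"
    and Basis :: "'v set"
    and d :: nat
    and A As \<Psi> :: "'v \<Rightarrow> 'v"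
    and E Es :: "nat \<Rightarrow> 'v \<Rightarrow> 'v"
  assumes "finite_dimensional_vector_space scale Basis"
    and "0 < vector_space.dim scale (UNIV :: 'v set)"
    and "1 \<le> d"
    and "td_system scale d A E As Es"
    and "is_Psi scale d A E Es \<Psi>"
  shows "\<forall>i\<le>d. \<Psi> ` range (E i) \<subseteq> adjacent_sum d (\<lambda>h. range (E h)) i"
proof -
  let ?\<theta> = "theta scale A E"
  interpret tridiagonal_setting scale Basis A E ?\<theta> As Es "theta scale As Es" d
    by (rule td_system_setting[OF assms(1,4)])
  have lin: "Vector_Spaces.linear scale scale \<Psi>" using assms(5) unfolding is_Psi_def by blast
  have \<Psi>: "\<Psi> (A.at_A (tau ?\<theta> i (int j)) v) =
      scale (vartheta d ?\<theta> j - vartheta d ?\<theta> i) (A.at_A (tau ?\<theta> i (int j - 1)) v)"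
    if "2 * i \<le> d" "i \<le> j" "j \<le> d - i" "v \<in> K i" for i j v
    using assms(5) that unfolding is_Psi_def Let_def K_eq_K_space[OF that(1)] by blast
  have far: "E h (\<Psi> (E k v)) = 0" if "h \<le> d" "k \<le> d" "Suc k < h \<or> Suc h < k" for h k v
  proof (rule lowering_tridiagonal[OF lin _ _ _ that])
    \<comment> \<open>The rule for \<open>j = i\<close>, whose coefficient \<open>\<vartheta>\<^sub>i - \<vartheta>\<^sub>i\<close> is zero.\<close>
    show "\<Psi> v = 0" if "2 * i \<le> d" "v \<in> K i" for i v
      using \<Psi>[of i i v] that by (simp add: tau_eq_newton newton_same A.at_A_1)
    show "\<Psi> (A.at_A (newton ?\<theta> i (i + Suc j)) v)
        = scale (vartheta d ?\<theta> (i + Suc j) - vartheta d ?\<theta> i) (A.at_A (newton ?\<theta> i (i + j)) v)"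
      if "i + (i + Suc j) \<le> d" "v \<in> K i" for i j v
    proof -
      have "int (i + Suc j) - 1 = int (i + j)" by simp
      moreover have "2 * i \<le> d" "i + Suc j \<le> d - i" using that(1) by simp_all
      ultimately show ?thesis
        using \<Psi>[of i "i + Suc j" v] that(2)
          tau_eq_newton[of i "i + Suc j" ?\<theta>] tau_eq_newton[of i "i + j" ?\<theta>] by simp
    qed
    show "vartheta d ?\<theta> (Suc j)
        = vartheta d ?\<theta> j + inverse (?\<theta> 0 - ?\<theta> d) * (?\<theta> j - ?\<theta> (d - j))" for j
      by (simp add: vartheta_def divide_inverse mult.commute)
  qed
  show ?thesis
  proof (intro allI impI image_subsetI)
    fix k x assume k: "k \<le> d" and "x \<in> range (E k)"
    then obtain v where "x = E k v" by blast
    then show "\<Psi> x \<in> adjacent_sum d (\<lambda>h. range (E h)) k"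
      using far k unfolding A.adjacent_sum_coordinates[OF k] by blast
  qed
qed

end
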